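(* $\mathcal{RD}_{\text{VKG*}}=\mathcal{RD}_{\text{VKG}}$.
   Context: Let $\mathcal{X}$ and $\hat{\mathcal{X}}$ be finite sets, $p_X$ a distribution on $\mathcal{X}$, $X$ a random variable with distribution $p_X$, and $d:\mathcal{X}\times\hat{\mathcal{X}}\to[0,\infty)$ a distortion measure. Let $L$ be a positive integer, $\mathcal{I}_L=\{1,\dots,L\}$. For a set $\mathcal{A}$, $2^{\mathcal{A}}$ is its power set; for a collection of sets $\mathcal{B}$, $X_{(\mathcal{B})}=\{X_{\mathcal{A}}:\mathcal{A}\in\mathcal{B}\}$ (so $X_{(\emptyset)}$ is a constant). $R_{\mathcal{K}}=\sum_{k\in\mathcal{K}}R_k$. All auxiliary random variables take values in finite sets. The VKG region $\mathcal{RD}_{\text{VKG}}$ is the set of tuples $(R_1,\dots,R_L,D_{\mathcal{K}},\emptyset\subset\mathcal{K}\subseteq\mathcal{I}_L)$ for which there exist auxiliary random variables $X_{\mathcal{K}}$, $\mathcal{K}\subseteq\mathcal{I}_L$ (including $X_\emptyset$), jointly distributed with $X$, and functions $\phi_{\mathcal{K}}$, $\emptyset\subset\mathcal{K}\subseteq\mathcal{I}_L$, with values in $\hat{\mathcal{X}}$, such that $R_{\mathcal{K}}\ge\psi(\mathcal{K})$ and $D_{\mathcal{K}}\ge\mathbb{E}[d(X,\phi_{\mathcal{K}}(X_{(2^{\mathcal{K}})}))]$ for all $\emptyset\subset\mathcal{K}\subseteq\mathcal{I}_L$, where $\psi(\mathcal{K})=(|\mathcal{K}|-1)I(X;X_{\emptyset})-H(X_{(2^{\mathcal{K}})}|X)+\sum_{\mathcal{A}\subseteq\mathcal{K}}H(X_{\mathcal{A}}|X_{(2^{\mathcal{A}}-\{\mathcal{A}\})})$.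 The VKG* region $\mathcal{RD}_{\text{VKG*}}$ is defined in the same way, except that $X_{\mathcal{I}_L}$ is required to be a constant. *)

theory Defs
  imports "HOL-Probability.Probability"
begin

text \<open>Auxiliary random variables take values in finite subsets of nat (every finite
alphabet embeds into nat). A joint distribution of X and the family
(X_A)_{A} is a pmf on 'x \<times> (nat set \<Rightarrow> nat); component A of the second
coordinate is X_A.\<close>

type_synonym 'x joint = "('x \<times> (nat set \<Rightarrow> nat)) pmf"

definition ent :: "('w pmf) \<Rightarrow> ('w \<Rightarrow> 'v) \<Rightarrow> real" where
  "ent P f = (\<Sum>v \<in> f ` set_pmf P. - (pmf (map_pmf f P) v) * log 2 (pmf (map_pmf f P) v))"

definition cent :: "('w pmf) \<Rightarrow> ('w \<Rightarrow> 'v) \<Rightarrow> ('w \<Rightarrow> 'u) \<Rightarrow> real" where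
  "cent P f g = ent P (\<lambda>w. (f w, g w)) - ent P g"

definition minfo :: "('w pmf) \<Rightarrow> ('w \<Rightarrow> 'v) \<Rightarrow> ('w \<Rightarrow> 'u) \<Rightarrow> real" where
  "minfo P f g = ent P f + ent P g - ent P (\<lambda>w. (f w, g w))"

definition coll :: "nat set set \<Rightarrow> (nat set \<Rightarrow> nat) \<Rightarrow> (nat set \<Rightarrow> nat)" where
  "coll B u = (\<lambda>A. if A \<in> B then u A else 0)"

definition psi :: "'x joint \<Rightarrow> nat set \<Rightarrow> real" where
  "psi P K = (real (card K) - 1) * minfo P fst (\<lambda>w. snd w {})
     - cent P (\<lambda>w. coll (Pow K) (snd w)) fst
     + (\<Sum>A\<in>Pow K. cent P (\<lambda>w. snd w A) (\<lambda>w. coll (Pow A - {A}) (snd w)))"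

definition admissible :: "'x pmf \<Rightarrow> nat \<Rightarrow> 'x joint \<Rightarrow> bool" where
  "admissible pX L P \<longleftrightarrow> map_pmf fst P = pX \<and> finite (set_pmf P)"

definition region_cond ::
  "'x pmf \<Rightarrow> ('x \<Rightarrow> 'y \<Rightarrow> real) \<Rightarrow> nat \<Rightarrow> (nat \<Rightarrow> real) \<Rightarrow> (nat set \<Rightarrow> real)
     \<Rightarrow> 'x joint \<Rightarrow> (nat set \<Rightarrow> (nat set \<Rightarrow> nat) \<Rightarrow> 'y) \<Rightarrow> bool" where
  "region_cond pX d L R D P \<phi> \<longleftrightarrow>
     (\<forall>K. K \<noteq> {} \<and> K \<subseteq> {1..L} \<longrightarrow>
        sum R K \<ge> psi P K \<and>
        D K \<ge> measure_pmf.expectation P (\<lambda>w. d (fst w) (\<phi> K (coll (Pow K) (snd w)))))"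

text \<open>Membership of the tuple (R_1..R_L, D_K for nonempty K \<subseteq> {1..L}) in the VKG region;
only the values of R on {1..L} and D on nonempty subsets of {1..L} are relevant.\<close>
definition in_VKG ::
  "'x pmf \<Rightarrow> ('x \<Rightarrow> 'y \<Rightarrow> real) \<Rightarrow> nat \<Rightarrow> (nat \<Rightarrow> real) \<Rightarrow> (nat set \<Rightarrow> real) \<Rightarrow> bool" where
  "in_VKG pX d L R D \<longleftrightarrow>
     (\<exists>P \<phi>. admissible pX L P \<and> region_cond pX d L R D P \<phi>)"

definition in_VKG_star ::
  "'x pmf \<Rightarrow> ('x \<Rightarrow> 'y \<Rightarrow> real) \<Rightarrow> nat \<Rightarrow> (nat \<Rightarrow> real) \<Rightarrow> (nat set \<Rightarrow> real) \<Rightarrow> bool" where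
  "in_VKG_star pX d L R D \<longleftrightarrow>
     (\<exists>P \<phi>. admissible pX L P \<and> (\<exists>c. \<forall>w\<in>set_pmf P. snd w {1..L} = c)
        \<and> region_cond pX d L R D P \<phi>)"

end

theory Submission
  imports Defs
begin

text \<open>Write $I = \{1,\dots,L\}$, $T = X_I$ and let $Y$ collect all the other layers. By the functional
representation lemma $T$ is a function of $Y$ and a variable $V$ independent of $Y$, with
$V$ conditionally independent of $X$ given $(T, Y)$. For $q \in I$, moving $V$ into the layer
$X_{\{q\}}$ makes $X_I$ constant, keeps every distortion, does not increase $\psi(I)$ and leaves
$\psi(K)$ unchanged when $q \notin K$; only sets $K \ni q$ with $K \neq I$ become more expensive. Since the
functions $\psi$ are supermodular, every feasible rate vector dominates a mixture over $q$ of these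
modified functions: a vertex of the rate polytope whose greedy order ends in $q$ does not see the
more expensive constraints. The mixture is realised by a time-sharing variable placed in
$X_\emptyset$. For $L = 1$ there is no separate layer $X_{\{q\}}$, and $X_I$ is moved into
$X_\emptyset$ instead.\<close>

section \<open>Entropy of finitely supported variables\<close>

lemma ent_eq:
  assumes "finite (set_pmf P)"
  shows "ent P f = measure_pmf.expectation P (\<lambda>w. - log 2 (pmf (map_pmf f P) (f w)))"
proof -
  have "measure_pmf.expectation P (\<lambda>w. - log 2 (pmf (map_pmf f P) (f w)))
      = measure_pmf.expectation (map_pmf f P) (\<lambda>v. - log 2 (pmf (map_pmf f P) v))"
    by simp
  also have "\<dots> = (\<Sum>v\<in>f ` set_pmf P. - log 2 (pmf (map_pmf f P) v) * pmf (map_pmf f P) v)"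
    using assms by (intro integral_measure_pmf_real) auto
  finally show ?thesis by (simp add: ent_def mult.commute)
qed

lemma pmf_map_eq_sum:
  assumes "finite (set_pmf P)"
  shows "pmf (map_pmf f P) y = (\<Sum>w\<in>set_pmf P. if f w = y then pmf P w else 0)"
proof -
  have "pmf (map_pmf f P) y = pmf (bind_pmf P (\<lambda>w. return_pmf (f w))) y"
    by (simp add: map_pmf_def)
  also have "\<dots> = (\<Sum>w\<in>set_pmf P. pmf (return_pmf (f w)) y * pmf P w)"
    unfolding pmf_bind by (rule integral_measure_pmf_real) (use assms in auto)
  also have "\<dots> = (\<Sum>w\<in>set_pmf P. if f w = y then pmf P w else 0)"
    by (intro sum.cong) (auto simp: indicator_def)
  finally show ?thesis .
qed

lemma pmf_map_pos: "w \<in> set_pmf P \<Longrightarrow> 0 < pmf (map_pmf f P) (f w)"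
  by (simp add: pmf_positive_iff)

text \<open>Entropy sees only the partition of the support that a variable induces. Variables of
  different types, such as a pair of layers and a collection, can therefore be exchanged without an
  explicit bijection.\<close>

lemma ent_cong_iff:
  assumes fin: "finite (set_pmf P)"
    and "\<And>w w'. w \<in> set_pmf P \<Longrightarrow> w' \<in> set_pmf P \<Longrightarrow> f w = f w' \<longleftrightarrow> g w = g w'"
  shows "ent P f = ent P g"
proof -
  have "pmf (map_pmf f P) (f w) = pmf (map_pmf g P) (g w)" if "w \<in> set_pmf P" for w
    unfolding pmf_map_eq_sum[OF fin] by (intro sum.cong) (auto simp: assms that)
  then show ?thesis
    unfolding ent_eq[OF fin] by (intro integral_cong_AE) (auto simp: AE_measure_pmf_iff)
qed

lemma ent_map: "ent (map_pmf h P) f = ent P (\<lambda>w. f (h w))"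
  by (simp add: ent_def map_pmf_comp image_image)

lemma ent_const:
  assumes "\<And>w. w \<in> set_pmf P \<Longrightarrow> f w = c"
  shows "ent P f = 0"
proof -
  have "map_pmf f P = map_pmf (\<lambda>_. c) P" by (intro map_pmf_cong) (auto simp: assms)
  moreover have "f ` set_pmf P = {c}" using assms set_pmf_not_empty[of P] by auto
  ultimately show ?thesis by (simp add: ent_def)
qed

text \<open>The joint variable and the common part are specified only up to relabelling, through the
partitions of the support that they induce.\<close>

lemma ent_submodular:
  assumes fin: "finite (set_pmf P)"
    and fc: "\<And>w w'. w \<in> set_pmf P \<Longrightarrow> w' \<in> set_pmf P \<Longrightarrow> f w = f w' \<Longrightarrow> c w = c w'"
    and gc: "\<And>w w'. w \<in> set_pmf P \<Longrightarrow> w' \<in> set_pmf P \<Longrightarrow> g w = g w' \<Longrightarrow> c w = c w'"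
    and j: "\<And>w w'. w \<in> set_pmf P \<Longrightarrow> w' \<in> set_pmf P \<Longrightarrow> j w = j w' \<longleftrightarrow> f w = f w' \<and> g w = g w'"
  shows "ent P j + ent P c \<le> ent P f + ent P g"
proof -
  define S where "S = set_pmf P"
  define p where "p = pmf P"
  define pf where "pf = (\<lambda>w. pmf (map_pmf f P) (f w))"
  define pg where "pg = (\<lambda>w. pmf (map_pmf g P) (g w))"
  define pj where "pj = (\<lambda>w. pmf (map_pmf j P) (j w))"
  define pc where "pc = (\<lambda>w. pmf (map_pmf c P) (c w))"
  have pos: "0 < p w" "0 < pf w" "0 < pg w" "0 < pj w" "0 < pc w" if "w \<in> S" for w
    using that by (auto simp: S_def p_def pf_def pg_def pj_def pc_def pmf_map_pos pmf_positive_iff)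
  have sump: "sum p S = 1" unfolding S_def p_def using fin by (simp add: sum_pmf_eq_1)
  have ent_sum: "ent P h = (\<Sum>w\<in>S. - log 2 (pmf (map_pmf h P) (h w)) * p w)" for h :: "'a \<Rightarrow> 'z"
    unfolding ent_eq[OF fin] S_def p_def by (rule integral_measure_pmf_real) (use fin in auto)
  have expand: "pmf (map_pmf h P) y = (\<Sum>w\<in>S. if h w = y then p w else 0)" for h :: "'a \<Rightarrow> 'z" and y
    unfolding S_def p_def by (rule pmf_map_eq_sum[OF fin])
  \<comment> \<open>The points \<open>w\<close> that agree with \<open>w1\<close> in
    \<open>f\<close> and with \<open>w2\<close> in \<open>g\<close> form at most one cell of
    \<open>j\<close>. On it \<open>pj\<close> and \<open>pc\<close> are constant, so the sum is
    \<open>pj / (pj * pc)\<close>, and a nonempty cell forces \<open>c w1 = c w2\<close>.\<close>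
  have inner: "(\<Sum>w\<in>S. if f w1 = f w \<and> g w2 = g w then p w / (pj w * pc w) else 0)
      \<le> (if c w2 = c w1 then 1 / pc w1 else 0)" (is "?l \<le> ?r")
    if w12: "w1 \<in> S" "w2 \<in> S" for w1 w2
  proof (cases "\<exists>w\<in>S. f w1 = f w \<and> g w2 = g w")
    case True
    then obtain w where w: "w \<in> S" "f w1 = f w" "g w2 = g w" by blast
    have eqc: "c w1 = c w" "c w2 = c w" using fc[of w1 w] gc[of w2 w] w w12 by (simp_all add: S_def)
    have "?l = (\<Sum>w'\<in>S. if j w' = j w then p w' / (pj w * pc w) else 0)"
    proof (intro sum.cong refl)
      fix w' assume w': "w' \<in> S"
      have e: "f w1 = f w' \<and> g w2 = g w' \<longleftrightarrow> j w' = j w"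
        using j[of w' w] w w' unfolding S_def by metis
      show "(if f w1 = f w' \<and> g w2 = g w' then p w' / (pj w' * pc w') else 0)
        = (if j w' = j w then p w' / (pj w * pc w) else 0)"
      proof (cases "j w' = j w")
        case True
        then have "f w' = f w" using e w by simp
        then have "c w' = c w" using fc[of w' w] w(1) w' by (simp add: S_def)
        with True show ?thesis unfolding e by (simp add: pj_def pc_def)
      qed (simp add: e)
    qed
    also have "\<dots> = (\<Sum>w'\<in>S. if j w' = j w then p w' else 0) / (pj w * pc w)"
      by (auto simp: sum_divide_distrib intro!: sum.cong)
    also have "\<dots> = pj w / (pj w * pc w)" by (simp add: pj_def expand)
    also have "\<dots> = ?r" using pos[OF w(1)] eqc by (simp add: pc_def)
    finally show ?thesis by simp
  next
    case False
    then have "?l = 0" by (intro sum.neutral) auto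
    then show ?thesis using pos[OF w12(1)] by simp
  qed
  \<comment> \<open>Writing \<open>pf w\<close> and \<open>pg w\<close> as sums over
    \<open>w1\<close> and \<open>w2\<close> and summing over \<open>w\<close> first reduces the
    bound by 1 to \<open>inner\<close>.\<close>
  have "(\<Sum>w\<in>S. p w * (pf w * pg w / (pj w * pc w)))
      = (\<Sum>w\<in>S. \<Sum>w1\<in>S. \<Sum>w2\<in>S. p w1 * p w2 * (if f w1 = f w \<and> g w2 = g w then p w / (pj w * pc w) else 0))"
  proof (intro sum.cong refl)
    fix w assume "w \<in> S"
    have "p w * (pf w * pg w / (pj w * pc w)) = pf w * pg w * (p w / (pj w * pc w))" by simp
    also have "\<dots> = (\<Sum>w1\<in>S. \<Sum>w2\<in>S. (if f w1 = f w then p w1 else 0) * (if g w2 = g w then p w2 else 0)) * (p w / (pj w * pc w))"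
      unfolding pf_def pg_def expand by (simp only: sum_product)
    also have "\<dots> = (\<Sum>w1\<in>S. \<Sum>w2\<in>S. p w1 * p w2 * (if f w1 = f w \<and> g w2 = g w then p w / (pj w * pc w) else 0))"
      unfolding sum_distrib_right by (intro sum.cong refl) auto
    finally show "p w * (pf w * pg w / (pj w * pc w)) = (\<Sum>w1\<in>S. \<Sum>w2\<in>S. p w1 * p w2 * (if f w1 = f w \<and> g w2 = g w then p w / (pj w * pc w) else 0))"
      .
  qed
  also have "\<dots> = (\<Sum>w1\<in>S. \<Sum>w\<in>S. \<Sum>w2\<in>S. p w1 * p w2 * (if f w1 = f w \<and> g w2 = g w then p w / (pj w * pc w) else 0))"
    by (rule sum.swap)
  also have "\<dots> = (\<Sum>w1\<in>S. \<Sum>w2\<in>S. \<Sum>w\<in>S. p w1 * p w2 * (if f w1 = f w \<and> g w2 = g w then p w / (pj w * pc w) else 0))"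
    by (intro sum.cong refl sum.swap)
  also have "\<dots> = (\<Sum>w1\<in>S. \<Sum>w2\<in>S. p w1 * p w2 * (\<Sum>w\<in>S. if f w1 = f w \<and> g w2 = g w then p w / (pj w * pc w) else 0))"
    by (simp add: sum_distrib_left)
  also have "\<dots> \<le> (\<Sum>w1\<in>S. \<Sum>w2\<in>S. p w1 * p w2 * (if c w2 = c w1 then 1 / pc w1 else 0))"
    using pos by (intro sum_mono mult_left_mono inner) (auto intro: less_imp_le)
  also have "\<dots> = (\<Sum>w1\<in>S. p w1 / pc w1 * (\<Sum>w2\<in>S. if c w2 = c w1 then p w2 else 0))"
    by (auto simp: sum_distrib_left intro!: sum.cong)
  also have "\<dots> = (\<Sum>w1\<in>S. p w1 / pc w1 * pc w1)" by (simp add: pc_def expand)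
  also have "\<dots> = 1" using pos sump by (simp add: less_imp_neq[symmetric] cong: sum.cong)
  finally have le1: "(\<Sum>w\<in>S. p w * (pf w * pg w / (pj w * pc w))) \<le> 1" .
  have "ent P j + ent P c - ent P f - ent P g = (\<Sum>w\<in>S. p w * log 2 (pf w * pg w / (pj w * pc w)))"
  proof -
    have "p w * log 2 (pf w * pg w / (pj w * pc w)) =
       - log 2 (pj w) * p w + - log 2 (pc w) * p w - (- log 2 (pf w) * p w) - (- log 2 (pg w) * p w)"
      if "w \<in> S" for w
      using pos[OF that] by (simp add: log_mult log_divide algebra_simps)
    then show ?thesis
      by (simp add: ent_sum pf_def pg_def pj_def pc_def sum_subtractf sum.distrib sum_negf)
  qed
  \<comment> \<open>The tangent bound ln x \<le> x - 1 replaces Jensen's inequality.\<close>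
  also have "\<dots> \<le> (\<Sum>w\<in>S. p w * ((pf w * pg w / (pj w * pc w) - 1) / ln 2))"
  proof (intro sum_mono mult_left_mono)
    fix w assume "w \<in> S"
    with pos[OF this] have "0 < pf w * pg w / (pj w * pc w)" by simp
    then show "log 2 (pf w * pg w / (pj w * pc w)) \<le> (pf w * pg w / (pj w * pc w) - 1) / ln 2"
      unfolding log_def by (intro divide_right_mono ln_le_minus_one) auto
  qed (use pos in \<open>auto intro: less_imp_le\<close>)
  also have "\<dots> = ((\<Sum>w\<in>S. p w * (pf w * pg w / (pj w * pc w))) - sum p S) / ln 2"
    by (simp add: sum_divide_distrib sum_subtractf[symmetric] algebra_simps cong: sum.cong)
  also have "\<dots> \<le> 0" using le1 sump by (simp add: divide_nonpos_nonneg)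
  finally show ?thesis by simp
qed

text \<open>This is the chain rule for a mixture whose index can be read off: since
  \<open>\<tau>\<close> recovers \<open>q\<close> from \<open>f w\<close>, the laws of
  \<open>f\<close> under the different \<open>P q\<close> have disjoint supports, and each
  probability factors as the weight of \<open>q\<close> times a probability under
  \<open>P q\<close>.\<close>

lemma ent_bind:
  assumes fin: "finite (set_pmf \<Lambda>)" "\<And>q. q \<in> set_pmf \<Lambda> \<Longrightarrow> finite (set_pmf (P q))"
    and tag: "\<And>q w. q \<in> set_pmf \<Lambda> \<Longrightarrow> w \<in> set_pmf (P q) \<Longrightarrow> \<tau> (f w) = q"
  shows "ent (bind_pmf \<Lambda> P) f
    = ent \<Lambda> (\<lambda>q. q) + measure_pmf.expectation \<Lambda> (\<lambda>q. ent (P q) f)"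
proof -
  let ?B = "bind_pmf \<Lambda> P"
  have finB: "finite (set_pmf ?B)" using fin by simp
  have pB: "pmf (map_pmf f ?B) (f w) = pmf \<Lambda> q * pmf (map_pmf f (P q)) (f w)"
    if q: "q \<in> set_pmf \<Lambda>" and w: "w \<in> set_pmf (P q)" for q w
  proof -
    have "pmf (map_pmf f ?B) (f w) = (\<Sum>q'\<in>set_pmf \<Lambda>. pmf (map_pmf f (P q')) (f w) * pmf \<Lambda> q')"
      unfolding map_bind_pmf pmf_bind by (rule integral_measure_pmf_real) (use fin in auto)
    also have "\<dots> = (\<Sum>q'\<in>set_pmf \<Lambda>. if q' = q then pmf (map_pmf f (P q)) (f w) * pmf \<Lambda> q else 0)"
    proof (intro sum.cong refl)
      fix q' assume q': "q' \<in> set_pmf \<Lambda>"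
      have "f w \<notin> f ` set_pmf (P q')" if "q' \<noteq> q"
        using tag[OF q w] tag[OF q'] that by auto
      then have "pmf (map_pmf f (P q')) (f w) = 0" if "q' \<noteq> q"
        using that by (simp add: pmf_eq_0_set_pmf)
      then show "pmf (map_pmf f (P q')) (f w) * pmf \<Lambda> q' = (if q' = q then pmf (map_pmf f (P q)) (f w) * pmf \<Lambda> q else 0)"
        by auto
    qed
    finally show ?thesis using fin q by (simp add: mult.commute)
  qed
  have "ent ?B f = (\<Sum>q\<in>set_pmf \<Lambda>. pmf \<Lambda> q *\<^sub>R measure_pmf.expectation (P q) (\<lambda>w. - log 2 (pmf (map_pmf f ?B) (f w))))"
    unfolding ent_eq[OF finB] by (rule pmf_expectation_bind) (use fin in auto)
  also have "\<dots> = (\<Sum>q\<in>set_pmf \<Lambda>. - pmf \<Lambda> q * log 2 (pmf \<Lambda> q) + ent (P q) f * pmf \<Lambda> q)"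
  proof (intro sum.cong refl)
    fix q assume q: "q \<in> set_pmf \<Lambda>"
    have "measure_pmf.expectation (P q) (\<lambda>w. - log 2 (pmf (map_pmf f ?B) (f w)))
      = measure_pmf.expectation (P q) (\<lambda>w. - log 2 (pmf \<Lambda> q) + (- log 2 (pmf (map_pmf f (P q)) (f w))))"
    proof (intro integral_cong_AE)
      show "AE w in measure_pmf (P q). - log 2 (pmf (map_pmf f ?B) (f w))
         = - log 2 (pmf \<Lambda> q) + (- log 2 (pmf (map_pmf f (P q)) (f w)))"
        using pmf_positive[OF q] by (auto simp: AE_measure_pmf_iff pB[OF q] log_mult pmf_map_pos
            less_imp_neq[OF pmf_map_pos, symmetric])
    qed auto
    also have "\<dots> = - log 2 (pmf \<Lambda> q) + measure_pmf.expectation (P q) (\<lambda>w. - log 2 (pmf (map_pmf f (P q)) (f w)))"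
      using fin(2)[OF q] by (subst Bochner_Integration.integral_add)
        (auto intro: integrable_measure_pmf_finite simp del: Bochner_Integration.integral_minus)
    also have "\<dots> = - log 2 (pmf \<Lambda> q) + ent (P q) f" using ent_eq[OF fin(2)[OF q]] by metis
    finally show "pmf \<Lambda> q *\<^sub>R measure_pmf.expectation (P q) (\<lambda>w. - log 2 (pmf (map_pmf f ?B) (f w)))
      = - pmf \<Lambda> q * log 2 (pmf \<Lambda> q) + ent (P q) f * pmf \<Lambda> q" by (simp add: algebra_simps)
  qed
  also have "\<dots> = ent \<Lambda> (\<lambda>q. q) + measure_pmf.expectation \<Lambda> (\<lambda>q. ent (P q) f)"
  proof -
    have "measure_pmf.expectation \<Lambda> (\<lambda>q. ent (P q) f) = (\<Sum>q\<in>set_pmf \<Lambda>. ent (P q) f * pmf \<Lambda> q)"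
      by (rule integral_measure_pmf_real) (use fin(1) in auto)
    moreover have "ent \<Lambda> (\<lambda>q. q) = (\<Sum>q\<in>set_pmf \<Lambda>. - pmf \<Lambda> q * log 2 (pmf \<Lambda> q))"
      by (simp add: ent_def)
    ultimately show ?thesis by (simp only: sum.distrib)
  qed
  finally show ?thesis .
qed

section \<open>Supermodular functions and mixtures\<close>

definition supermodular_on :: "'a set \<Rightarrow> ('a set \<Rightarrow> real) \<Rightarrow> bool" where
  "supermodular_on I f \<longleftrightarrow> (\<forall>S T. S \<subseteq> I \<longrightarrow> T \<subseteq> I \<longrightarrow> f S + f T \<le> f (S \<union> T) + f (S \<inter> T))"

lemma supermodular_onD:
  "supermodular_on I f \<Longrightarrow> S \<subseteq> I \<Longrightarrow> T \<subseteq> I \<Longrightarrow> f S + f T \<le> f (S \<union> T) + f (S \<inter> T)"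
  by (simp add: supermodular_on_def)

text \<open>If \<open>S\<close> or \<open>T\<close> is \<open>I\<close>, both sides coincide.
  Otherwise the intersection is not \<open>I\<close>, so raising the value at \<open>I\<close> can
  only enlarge the right-hand side.\<close>

lemma supermodular_on_raise_top:
  assumes "supermodular_on I f" "f I \<le> c"
  shows "supermodular_on I (f(I := c))"
  unfolding supermodular_on_def
proof (intro allI impI)
  fix S T assume ST: "S \<subseteq> I" "T \<subseteq> I"
  show "(f(I := c)) S + (f(I := c)) T \<le> (f(I := c)) (S \<union> T) + (f(I := c)) (S \<inter> T)"
  proof (cases "S = I \<or> T = I")
    case True
    then show ?thesis using ST by (auto simp: Un_absorb1 Un_absorb2 Int_absorb1 Int_absorb2)
  next
    case False
    then have "S \<inter> T \<noteq> I" using ST by blast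
    then show ?thesis using False supermodular_onD[OF assms(1) ST] assms(2) by auto
  qed
qed

text \<open>Uncrossing: \<open>sum R\<close> is modular and dominates the supermodular
  \<open>f\<close>, so equality at two sets forces equality at their union.\<close>

lemma tight_Un:
  fixes f :: "'a set \<Rightarrow> real"
  assumes "finite I" "supermodular_on I f" "\<And>K. K \<subseteq> I \<Longrightarrow> f K \<le> sum R K"
    and "S \<subseteq> I" "T \<subseteq> I" "sum R S = f S" "sum R T = f T"
  shows "sum R (S \<union> T) = f (S \<union> T)"
proof -
  have "finite S" "finite T" using assms finite_subset by blast+
  then have "sum R (S \<union> T) + sum R (S \<inter> T) = sum R S + sum R T" by (rule sum.union_inter)
  moreover have "f (S \<union> T) \<le> sum R (S \<union> T)" "f (S \<inter> T) \<le> sum R (S \<inter> T)"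
    using assms by (auto intro!: assms(3))
  moreover have "f S + f T \<le> f (S \<union> T) + f (S \<inter> T)"
    by (rule supermodular_onD[OF assms(2,4,5)])
  ultimately show ?thesis using assms(6,7) by linarith
qed

text \<open>Take a maximal proper tight set \<open>M\<close>. If two points lay outside it, a tight
  set separating them could be joined to \<open>M\<close>; the union would be tight, strictly
  larger, and still proper because it misses one of the two points.\<close>

lemma tight_remove:
  fixes f :: "'a set \<Rightarrow> real"
  assumes fin: "finite I" "I \<noteq> {}" and super: "supermodular_on I f"
    and feas: "\<And>K. K \<subseteq> I \<Longrightarrow> f K \<le> sum R K" and f0: "f {} = 0"
    and sep: "\<And>i j. i \<in> I \<Longrightarrow> j \<in> I \<Longrightarrow> i \<noteq> j \<Longrightarrow> \<exists>C\<subseteq>I. sum R C = f C \<and> (i \<in> C \<longleftrightarrow> j \<notin> C)"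
  shows "\<exists>c\<in>I. sum R (I - {c}) = f (I - {c})"
proof -
  define F where "F = {M. M \<subset> I \<and> sum R M = f M}"
  have "finite F" using fin by (intro finite_subset[of F "Pow I"]) (auto simp: F_def)
  moreover have "F \<noteq> {}" using fin f0 by (auto simp: F_def intro!: exI[of _ "{}"])
  ultimately obtain M where M: "M \<in> F" and max: "\<And>N. N \<in> F \<Longrightarrow> M \<subseteq> N \<Longrightarrow> M = N"
    using finite_has_maximal[of F] by blast
  obtain c where c: "c \<in> I" "c \<notin> M" using M F_def by blast
  have "x = c" if x: "x \<in> I" "x \<notin> M" for x
  proof (rule ccontr)
    assume "x \<noteq> c"
    then obtain D where D: "D \<subseteq> I" "sum R D = f D" "x \<in> D \<longleftrightarrow> c \<notin> D"
      using sep[of x c] x c by auto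
    have MI: "M \<subseteq> I" "sum R M = f M" using M by (auto simp: F_def)
    have "sum R (M \<union> D) = f (M \<union> D)"
      by (rule tight_Un[OF fin(1) super feas MI(1) D(1) MI(2) D(2)])
    then have "M \<union> D \<in> F" using M D x c by (auto simp: F_def)
    then show False using max[of "M \<union> D"] x c D(3) by blast
  qed
  then have "M = I - {c}" using M c unfolding F_def by blast
  then show ?thesis using M c by (auto simp: F_def)
qed

text \<open>Tightness at \<open>I\<close> and at \<open>I - {k}\<close> means that \<open>k\<close>
  comes last in the greedy order, with \<open>R k = f I - f (I - {k})\<close>. For \<open>K\<close>
  containing \<open>k\<close>, supermodularity of \<open>g\<close> at \<open>I - {k}\<close> and
  \<open>K\<close> bounds \<open>g K\<close> by \<open>R k + f (K - {k})\<close>; all other values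
  of \<open>g\<close> involved agree with those of \<open>f\<close>.\<close>

lemma feasible_of_tight_remove:
  fixes f g :: "'a set \<Rightarrow> real"
  assumes fin: "finite I" and gsuper: "supermodular_on I g"
    and feas: "\<And>K. K \<subseteq> I \<Longrightarrow> f K \<le> sum R K"
    and top: "sum R I = f I" "g I = f I"
    and k: "k \<in> I" "sum R (I - {k}) = f (I - {k})"
    and gf: "\<And>K. K \<subseteq> I - {k} \<Longrightarrow> g K = f K"
    and K: "K \<subseteq> I"
  shows "g K \<le> sum R K"
proof (cases "k \<in> K")
  case False
  then have "K \<subseteq> I - {k}" using K by auto
  then show ?thesis using gf feas[OF K] by simp
next
  case True
  have eqs: "(I - {k}) \<union> K = I" "(I - {k}) \<inter> K = K - {k}" using K True by auto
  have "g (I - {k}) + g K \<le> g I + g (K - {k})"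
    using supermodular_onD[OF gsuper, of "I - {k}" K] K by (simp add: eqs)
  moreover have "g (I - {k}) = f (I - {k})" "g (K - {k}) = f (K - {k})" using K by (auto intro!: gf)
  moreover have "f (K - {k}) \<le> sum R (K - {k})" using K by (intro feas) auto
  moreover have "sum R I = R k + sum R (I - {k})" using fin k by (simp add: sum.remove)
  moreover have "sum R K = R k + sum R (K - {k})"
    using True finite_subset[OF K fin] by (simp add: sum.remove)
  ultimately show ?thesis using top k by linarith
qed

definition shift_mass :: "'a \<Rightarrow> 'a \<Rightarrow> real \<Rightarrow> ('a \<Rightarrow> real) \<Rightarrow> 'a \<Rightarrow> real" where
  "shift_mass i j t R = (\<lambda>x. R x + (if x = i then t else 0) - (if x = j then t else 0))"

lemma sum_shift_mass:
  "finite K \<Longrightarrow> sum (shift_mass i j t R) K = sum R K + (if i \<in> K then t else 0) - (if j \<in> K then t else 0)"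
  by (simp add: shift_mass_def sum.distrib sum_subtractf)

text \<open>Moving mass from \<open>j\<close> to \<open>i\<close> lowers the sum only on sets that
  contain \<open>j\<close> but not \<open>i\<close>, and \<open>t\<close> is their smallest slack.
  Tight sets stay tight because none separates \<open>i\<close> from \<open>j\<close>, while a set
  attaining the minimum becomes tight. The decreasing count is the induction measure below.\<close>

lemma shift_until_tight:
  fixes f :: "'a set \<Rightarrow> real"
  assumes fin: "finite I" and feas: "\<And>K. K \<subseteq> I \<Longrightarrow> f K \<le> sum R K"
    and ij: "i \<in> I" "j \<in> I" "i \<noteq> j"
    and nosep: "\<And>C. C \<subseteq> I \<Longrightarrow> sum R C = f C \<Longrightarrow> i \<in> C \<longleftrightarrow> j \<in> C"
  shows "\<exists>t>0. (\<forall>K\<subseteq>I. f K \<le> sum (shift_mass i j t R) K) \<and>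
    card {K. K \<subseteq> I \<and> sum (shift_mass i j t R) K \<noteq> f K} < card {K. K \<subseteq> I \<and> sum R K \<noteq> f K}"
proof -
  define A where "A = {K. K \<subseteq> I \<and> j \<in> K \<and> i \<notin> K}"
  define t where "t = Min ((\<lambda>K. sum R K - f K) ` A)"
  have finA: "finite A" using fin by (intro finite_subset[of A "Pow I"]) (auto simp: A_def)
  have neA: "A \<noteq> {}" using ij by (auto simp: A_def intro!: exI[of _ "{j}"])
  have tle: "t \<le> sum R K - f K" if "K \<in> A" for K
    unfolding t_def using finA that by (intro Min_le) auto
  have "t \<in> (\<lambda>K. sum R K - f K) ` A" unfolding t_def using finA neA by (intro Min_in) auto
  then obtain K0 where K0: "K0 \<in> A" "t = sum R K0 - f K0" by auto
  have tpos: "0 < t" using K0 feas[of K0] nosep[of K0] by (force simp: A_def)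
  have sumK: "sum (shift_mass i j t R) K = sum R K + (if i \<in> K then t else 0) - (if j \<in> K then t else 0)"
    if "K \<subseteq> I" for K using sum_shift_mass finite_subset[OF that fin] by metis
  have feas': "f K \<le> sum (shift_mass i j t R) K" if K: "K \<subseteq> I" for K
    using feas[OF K] tle[of K] tpos K unfolding sumK[OF K] by (auto simp: A_def)
  have "{K. K \<subseteq> I \<and> sum (shift_mass i j t R) K \<noteq> f K} \<subset> {K. K \<subseteq> I \<and> sum R K \<noteq> f K}"
  proof
    show "{K. K \<subseteq> I \<and> sum (shift_mass i j t R) K \<noteq> f K} \<subseteq> {K. K \<subseteq> I \<and> sum R K \<noteq> f K}"
    proof safe
      fix K assume "K \<subseteq> I" "sum (shift_mass i j t R) K \<noteq> f K" "sum R K = f K"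
      then show False using sumK[of K] nosep[of K] by simp
    qed
    have "K0 \<subseteq> I" "sum (shift_mass i j t R) K0 = f K0" "sum R K0 \<noteq> f K0"
      using K0 tpos sumK[of K0] by (auto simp: A_def)
    then show "{K. K \<subseteq> I \<and> sum (shift_mass i j t R) K \<noteq> f K} \<noteq> {K. K \<subseteq> I \<and> sum R K \<noteq> f K}"
      by blast
  qed
  then have "card {K. K \<subseteq> I \<and> sum (shift_mass i j t R) K \<noteq> f K} < card {K. K \<subseteq> I \<and> sum R K \<noteq> f K}"
    using fin by (intro psubset_card_mono) auto
  with tpos feas' show ?thesis by blast
qed

text \<open>If no tight set separates \<open>i\<close> from \<open>j\<close>, then moving mass between \<open>i\<close> and \<open>j\<close> in either
direction until a new set becomes tight exhibits the point as a mixture of two points with more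
tight sets. Otherwise some complement of a singleton \<open>{k}\<close> is tight and \<open>g k\<close> alone works.\<close>

lemma mixture_of_base_point:
  fixes f :: "'a set \<Rightarrow> real" and g :: "'a \<Rightarrow> 'a set \<Rightarrow> real"
  assumes fin: "finite I" "I \<noteq> {}" and super: "supermodular_on I f" and f0: "f {} = 0"
    and gsuper: "\<And>k. k \<in> I \<Longrightarrow> supermodular_on I (g k)"
    and gf: "\<And>k K. k \<in> I \<Longrightarrow> K \<subseteq> I - {k} \<Longrightarrow> g k K = f K"
    and gtop: "\<And>k. k \<in> I \<Longrightarrow> g k I = f I"
    and "\<And>K. K \<subseteq> I \<Longrightarrow> f K \<le> sum R K" and "sum R I = f I"
  shows "\<exists>\<Lambda>. set_pmf \<Lambda> \<subseteq> I \<and> (\<forall>K\<subseteq>I. measure_pmf.expectation \<Lambda> (\<lambda>k. g k K) \<le> sum R K)"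
  using assms(8,9)
proof (induction "card {K. K \<subseteq> I \<and> sum R K \<noteq> f K}" arbitrary: R rule: less_induct)
  case less
  show ?case
  proof (cases "\<exists>i\<in>I. \<exists>j\<in>I. i \<noteq> j \<and> (\<forall>C\<subseteq>I. sum R C = f C \<longrightarrow> (i \<in> C \<longleftrightarrow> j \<in> C))")
    case False
    then have sep: "\<exists>C\<subseteq>I. sum R C = f C \<and> (i \<in> C \<longleftrightarrow> j \<notin> C)" if "i \<in> I" "j \<in> I" "i \<noteq> j" for i j
      using that by metis
    have "\<exists>k\<in>I. sum R (I - {k}) = f (I - {k})"
      by (rule tight_remove[OF fin super less.prems(1) f0 sep])
    then obtain k where k: "k \<in> I" "sum R (I - {k}) = f (I - {k})" by blast
    have "g k K \<le> sum R K" if "K \<subseteq> I" for K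
      by (rule feasible_of_tight_remove[OF fin(1) gsuper[OF k(1)] less.prems gtop[OF k(1)] k gf[OF k(1)] that])
    then show ?thesis using k by (intro exI[of _ "return_pmf k"]) auto
  next
    case True
    then obtain i j where ij: "i \<in> I" "j \<in> I" "i \<noteq> j"
      and nosep: "\<And>C. C \<subseteq> I \<Longrightarrow> sum R C = f C \<Longrightarrow> i \<in> C \<longleftrightarrow> j \<in> C" by blast
    have base: "sum (shift_mass i' j' t R) I = f I" if "i' \<in> I" "j' \<in> I" for i' j' t
      using sum_shift_mass[OF fin(1)] that less.prems(2) by simp
    obtain t where t: "0 < t" "\<And>K. K \<subseteq> I \<Longrightarrow> f K \<le> sum (shift_mass i j t R) K"
      "card {K. K \<subseteq> I \<and> sum (shift_mass i j t R) K \<noteq> f K} < card {K. K \<subseteq> I \<and> sum R K \<noteq> f K}"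
      using shift_until_tight[OF fin(1) less.prems(1) ij nosep] by blast
    have nosep': "j \<in> C \<longleftrightarrow> i \<in> C" if "C \<subseteq> I" "sum R C = f C" for C
      using nosep[OF that] by simp
    obtain s where s: "0 < s" "\<And>K. K \<subseteq> I \<Longrightarrow> f K \<le> sum (shift_mass j i s R) K"
      "card {K. K \<subseteq> I \<and> sum (shift_mass j i s R) K \<noteq> f K} < card {K. K \<subseteq> I \<and> sum R K \<noteq> f K}"
      using shift_until_tight[OF fin(1) less.prems(1) ij(2,1) ij(3)[symmetric] nosep'] by blast
    obtain \<Lambda> where \<Lambda>: "set_pmf \<Lambda> \<subseteq> I"
      "\<And>K. K \<subseteq> I \<Longrightarrow> measure_pmf.expectation \<Lambda> (\<lambda>k. g k K) \<le> sum (shift_mass i j t R) K"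
      using less.hyps[OF t(3,2) base[OF ij(1,2)]] by blast
    obtain \<Lambda>' where \<Lambda>': "set_pmf \<Lambda>' \<subseteq> I"
      "\<And>K. K \<subseteq> I \<Longrightarrow> measure_pmf.expectation \<Lambda>' (\<lambda>k. g k K) \<le> sum (shift_mass j i s R) K"
      using less.hyps[OF s(3,2) base[OF ij(2,1)]] by blast
    \<comment> \<open>With this weight the two opposite shifts cancel, so \<open>R\<close> is the
      convex combination of the two shifted points.\<close>
    define a where "a = s / (s + t)"
    have a: "0 \<le> a" "a \<le> 1" using s t by (auto simp: a_def)
    have at: "a * t = (1 - a) * s" using s(1) t(1) by (simp add: a_def field_simps)
    define M where "M = bind_pmf (bernoulli_pmf a) (\<lambda>b. if b then \<Lambda> else \<Lambda>')"
    have "set_pmf M \<subseteq> I" using \<Lambda>(1) \<Lambda>'(1) by (auto simp: M_def split: if_splits)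
    moreover have "measure_pmf.expectation M (\<lambda>k. g k K) \<le> sum R K" if K: "K \<subseteq> I" for K
    proof -
      have "finite (set_pmf (if b then \<Lambda> else \<Lambda>'))" for b
        using finite_subset[OF \<Lambda>(1) fin(1)] finite_subset[OF \<Lambda>'(1) fin(1)] by simp
      then have "measure_pmf.expectation M (\<lambda>k. g k K)
        = (\<Sum>b\<in>UNIV. pmf (bernoulli_pmf a) b *\<^sub>R measure_pmf.expectation (if b then \<Lambda> else \<Lambda>') (\<lambda>k. g k K))"
        unfolding M_def by (intro pmf_expectation_bind) auto
      also have "\<dots> = a * measure_pmf.expectation \<Lambda> (\<lambda>k. g k K)
         + (1 - a) * measure_pmf.expectation \<Lambda>' (\<lambda>k. g k K)"
        using a by (simp add: UNIV_bool)
      also have "\<dots> \<le> a * sum (shift_mass i j t R) K + (1 - a) * sum (shift_mass j i s R) K"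
        using a \<Lambda>(2)[OF K] \<Lambda>'(2)[OF K] by (intro add_mono mult_left_mono) auto
      also have "\<dots> = sum R K"
        using at finite_subset[OF K fin(1)] by (simp add: sum_shift_mass algebra_simps)
      finally show ?thesis .
    qed
    ultimately show ?thesis by blast
  qed
qed

text \<open>The general case reduces to a point with a tight total: the values of \<open>f\<close>
  and of every \<open>g k\<close> at \<open>I\<close> are raised to \<open>sum R I\<close>. Raising
  only increases \<open>g k\<close>, so the bound on the mixture carries back.\<close>

lemma contrapolymatroid_mixture:
  fixes f :: "'a set \<Rightarrow> real" and g :: "'a \<Rightarrow> 'a set \<Rightarrow> real"
  assumes fin: "finite I" "I \<noteq> {}" and super: "supermodular_on I f" and f0: "f {} = 0"
    and gsuper: "\<And>k. k \<in> I \<Longrightarrow> supermodular_on I (g k)"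
    and gf: "\<And>k K. k \<in> I \<Longrightarrow> K \<subseteq> I - {k} \<Longrightarrow> g k K = f K"
    and gtop: "\<And>k. k \<in> I \<Longrightarrow> g k I \<le> f I"
    and feas: "\<And>K. K \<subseteq> I \<Longrightarrow> f K \<le> sum R K"
  shows "\<exists>\<Lambda>. set_pmf \<Lambda> \<subseteq> I \<and> (\<forall>K\<subseteq>I. measure_pmf.expectation \<Lambda> (\<lambda>k. g k K) \<le> sum R K)"
proof -
  define c where "c = sum R I"
  have fc: "f I \<le> c" using feas by (simp add: c_def)
  have gc: "g k I \<le> c" if "k \<in> I" for k using gtop[OF that] fc by simp
  have "\<exists>\<Lambda>. set_pmf \<Lambda> \<subseteq> I \<and> (\<forall>K\<subseteq>I. measure_pmf.expectation \<Lambda> (\<lambda>k. ((g k)(I := c)) K) \<le> sum R K)"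
  proof (rule mixture_of_base_point[OF fin supermodular_on_raise_top[OF super fc]])
    show "supermodular_on I ((g k)(I := c))" if "k \<in> I" for k
      by (rule supermodular_on_raise_top[OF gsuper[OF that] gc[OF that]])
    show "((g k)(I := c)) K = (f(I := c)) K" if "k \<in> I" "K \<subseteq> I - {k}" for k K
    proof -
      have "K \<noteq> I" using that by auto
      then show ?thesis using gf[OF that] by simp
    qed
    show "(f(I := c)) K \<le> sum R K" if "K \<subseteq> I" for K
      using feas[OF that] by (cases "K = I") (simp_all add: c_def)
    show "(f(I := c)) {} = 0" using f0 fin(2) by simp
    show "sum R I = (f(I := c)) I" by (simp add: c_def)
  qed simp
  then obtain \<Lambda> where \<Lambda>: "set_pmf \<Lambda> \<subseteq> I"
    "\<And>K. K \<subseteq> I \<Longrightarrow> measure_pmf.expectation \<Lambda> (\<lambda>k. ((g k)(I := c)) K) \<le> sum R K" by blast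
  have "measure_pmf.expectation \<Lambda> (\<lambda>k. g k K) \<le> sum R K" if K: "K \<subseteq> I" for K
  proof -
    have fin\<Lambda>: "finite (set_pmf \<Lambda>)" using \<Lambda>(1) fin(1) by (rule finite_subset)
    have "measure_pmf.expectation \<Lambda> (\<lambda>k. g k K) \<le> measure_pmf.expectation \<Lambda> (\<lambda>k. ((g k)(I := c)) K)"
    proof (intro integral_mono_AE integrable_measure_pmf_finite fin\<Lambda>)
      have "g k K \<le> ((g k)(I := c)) K" if "k \<in> set_pmf \<Lambda>" for k
        using gc[of k] that \<Lambda>(1) by (cases "K = I") auto
      then show "AE k in measure_pmf \<Lambda>. g k K \<le> ((g k)(I := c)) K"
        by (simp add: AE_measure_pmf_iff)
    qed
    then show ?thesis using \<Lambda>(2)[OF K] by linarith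
  qed
  with \<Lambda>(1) show ?thesis by blast
qed

section \<open>The rate function\<close>

lemma coll_eq_iff: "coll B u = coll B u' \<longleftrightarrow> (\<forall>A\<in>B. u A = u' A)"
  by (auto simp: coll_def fun_eq_iff)

definition coll_ent :: "'x joint \<Rightarrow> nat set set \<Rightarrow> real" where
  "coll_ent P B = ent P (\<lambda>w. coll B (snd w))"

definition coll_src_ent :: "'x joint \<Rightarrow> nat set set \<Rightarrow> real" where
  "coll_src_ent P B = ent P (\<lambda>w. (coll B (snd w), fst w))"

text \<open>By the chain rule this difference is the conditional entropy of layer \<open>A\<close>
  given all layers indexed by proper subsets of \<open>A\<close>.\<close>

definition layer_ent :: "'x joint \<Rightarrow> nat set \<Rightarrow> real" where
  "layer_ent P A = coll_ent P (Pow A) - coll_ent P (Pow A - {A})"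

lemma coll_ent_empty: "coll_ent P {} = 0"
  unfolding coll_ent_def by (rule ent_const[where c = "\<lambda>_. 0"]) (simp add: coll_def fun_eq_iff)

text \<open>With every term expressed through joint entropies of collections, comparisons of rates
  become linear arithmetic.\<close>

lemma psi_eq:
  assumes fin: "finite (set_pmf P)"
  shows "psi P K = (real (card K) - 1) * (ent P fst + coll_ent P {{}} - coll_src_ent P {{}})
     - (coll_src_ent P (Pow K) - ent P fst) + (\<Sum>A\<in>Pow K. layer_ent P A)"
proof -
  have e: "ent P (\<lambda>w. snd w {}) = coll_ent P {{}}" "ent P (\<lambda>w. (fst w, snd w {})) = coll_src_ent P {{}}"
    "ent P (\<lambda>w. (snd w A, coll (Pow A - {A}) (snd w))) = coll_ent P (Pow A)" for A
    unfolding coll_ent_def coll_src_ent_def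
    by (rule ent_cong_iff[OF fin]; auto simp: coll_eq_iff)+
  show ?thesis unfolding psi_def minfo_def cent_def e
    by (simp add: coll_ent_def coll_src_ent_def layer_ent_def)
qed

text \<open>At the empty set the coefficient of the mutual information is -1, which cancels the
  other two terms.\<close>

lemma psi_empty:
  assumes fin: "finite (set_pmf P)"
  shows "psi P {} = 0"
  unfolding psi_eq[OF fin] by (simp add: layer_ent_def coll_ent_empty)

text \<open>Layers of \<open>C - B\<close> are removed one at a time, a maximal one first, so that
  the remaining family stays closed under subsets. Each layer costs at most
  \<open>layer_ent\<close>, because conditioning on the source and further layers does not increase
  entropy.\<close>

lemma coll_src_ent_diff_le:
  assumes fin: "finite (set_pmf P)" and B: "\<And>A A'. A \<in> B \<Longrightarrow> A' \<subseteq> A \<Longrightarrow> A' \<in> B"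
    and "finite C" "B \<subseteq> C" "\<And>A A'. A \<in> C \<Longrightarrow> A' \<subseteq> A \<Longrightarrow> A' \<in> C"
  shows "coll_src_ent P C - coll_src_ent P B \<le> (\<Sum>A\<in>C - B. layer_ent P A)"
  using assms(3-5)
proof (induction "card (C - B)" arbitrary: C)
  case 0
  then have "C = B" by auto
  then show ?case by simp
next
  case (Suc n)
  have "C - B \<noteq> {}" using Suc.hyps(2) by (metis card.empty nat.distinct(1))
  then obtain A where A: "A \<in> C - B" and max: "\<And>A'. A' \<in> C - B \<Longrightarrow> A \<subseteq> A' \<Longrightarrow> A = A'"
    using finite_has_maximal[of "C - B"] Suc.prems(1) by blast
  define C' where "C' = C - {A}"
  have "C - B = insert A (C' - B)" using A by (auto simp: C'_def)
  moreover have nin: "A \<notin> C' - B" by (simp add: C'_def)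
  moreover have finC': "finite (C' - B)" using Suc.prems(1) by (simp add: C'_def)
  ultimately have CB: "(\<Sum>A\<in>C - B. layer_ent P A) = layer_ent P A + (\<Sum>A\<in>C' - B. layer_ent P A)"
    and cardC: "n = card (C' - B)"
    using Suc.hyps(2) by simp_all
  have dc: "A2 \<in> C'" if "A1 \<in> C'" "A2 \<subseteq> A1" for A1 A2
  proof -
    have "A2 \<in> C" using Suc.prems(3)[of A1 A2] that by (simp add: C'_def)
    moreover have "A2 \<noteq> A"
    proof
      assume "A2 = A"
      then have "A1 \<notin> B" using B[of A1 A] that A by auto
      then show False using max[of A1] that \<open>A2 = A\<close> by (auto simp: C'_def)
    qed
    ultimately show ?thesis by (simp add: C'_def)
  qed
  have "finite C'" "B \<subseteq> C'" using Suc.prems(1,2) A by (auto simp: C'_def)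
  then have "coll_src_ent P C' - coll_src_ent P B \<le> (\<Sum>A\<in>C' - B. layer_ent P A)"
    by (rule Suc.hyps(1)[OF cardC _ _ dc])
  moreover have "coll_src_ent P C + coll_ent P (Pow A - {A}) \<le> coll_src_ent P C' + coll_ent P (Pow A)"
  proof -
    have "Pow A \<subseteq> C" using Suc.prems(3)[of A] A by blast
    then have sub: "Pow A - {A} \<subseteq> C'" "C = C' \<union> Pow A" using A unfolding C'_def by blast+
    show ?thesis unfolding coll_src_ent_def coll_ent_def
      by (rule ent_submodular[OF fin]) (use sub in \<open>auto simp: coll_eq_iff\<close>)
  qed
  ultimately show ?case unfolding CB layer_ent_def[of P A] by linarith
qed

text \<open>The cardinality term is modular, and the source entropies of \<open>Pow S\<close> and
  \<open>Pow T\<close> are submodular. Passing from \<open>Pow S \<union> Pow T\<close> to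
  \<open>Pow (S \<union> T)\<close> adds source entropy, which is paid for by the layers indexed by
  subsets of the union contained in neither set.\<close>

lemma psi_supermodular:
  assumes fin: "finite (set_pmf P)" and finI: "finite I"
  shows "supermodular_on I (psi P)"
  unfolding supermodular_on_def
proof (intro allI impI)
  fix S T assume ST: "S \<subseteq> I" "T \<subseteq> I"
  have finST: "finite S" "finite T" using ST finI finite_subset by blast+
  let ?l = "layer_ent P" and ?h = "coll_src_ent P"
  let ?i = "ent P fst + coll_ent P {{}} - ?h {{}}"
  have "real (card S) + real (card T) = real (card (S \<union> T)) + real (card (S \<inter> T))"
    using card_Un_Int[OF finST] by linarith
  then have c: "(real (card S) - 1) * ?i + (real (card T) - 1) * ?i
      = (real (card (S \<union> T)) - 1) * ?i + (real (card (S \<inter> T)) - 1) * ?i"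
    unfolding distrib_right[symmetric] by simp
  have s: "sum ?l (Pow S) + sum ?l (Pow T) = sum ?l (Pow S \<union> Pow T) + sum ?l (Pow (S \<inter> T))"
    using finST by (simp add: sum.union_inter)
  have sU: "sum ?l (Pow (S \<union> T)) = sum ?l (Pow S \<union> Pow T) + sum ?l (Pow (S \<union> T) - (Pow S \<union> Pow T))"
    using finST by (intro sum.subset_diff[THEN trans]) (auto simp: add.commute)
  have h: "?h (Pow S \<union> Pow T) + ?h (Pow (S \<inter> T)) \<le> ?h (Pow S) + ?h (Pow T)"
    unfolding coll_src_ent_def by (rule ent_submodular[OF fin]) (auto simp: coll_eq_iff)
  have hU: "?h (Pow (S \<union> T)) - ?h (Pow S \<union> Pow T) \<le> sum ?l (Pow (S \<union> T) - (Pow S \<union> Pow T))"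
    using finST by (intro coll_src_ent_diff_le[OF fin]) auto
  show "psi P S + psi P T \<le> psi P (S \<union> T) + psi P (S \<inter> T)"
    unfolding psi_eq[OF fin] using c s sU h hU by linarith
qed

lemma ent_eq_map: "ent P f = ent (map_pmf f P) (\<lambda>v. v)"
  by (simp add: ent_map)

section \<open>Time sharing\<close>

text \<open>Layer \<open>{}\<close> belongs to \<open>Pow K\<close> for every \<open>K\<close>, so
  an index stored there is visible to every reconstruction function.\<close>

definition tag_layer :: "nat \<Rightarrow> 'x \<times> (nat set \<Rightarrow> nat) \<Rightarrow> 'x \<times> (nat set \<Rightarrow> nat)" where
  "tag_layer q w = (fst w, (snd w)({} := prod_encode (q, snd w {})))"

definition time_share :: "nat pmf \<Rightarrow> (nat \<Rightarrow> 'x joint) \<Rightarrow> 'x joint" where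
  "time_share \<Lambda> P = bind_pmf \<Lambda> (\<lambda>q. map_pmf (tag_layer q) (P q))"

lemma map_fst_time_share:
  assumes "\<And>q. q \<in> set_pmf \<Lambda> \<Longrightarrow> map_pmf fst (P q) = pX"
  shows "map_pmf fst (time_share \<Lambda> P) = pX"
proof -
  have "map_pmf fst (time_share \<Lambda> P) = bind_pmf \<Lambda> (\<lambda>q. map_pmf fst (P q))"
    by (simp add: time_share_def map_bind_pmf map_pmf_comp tag_layer_def)
  also have "\<dots> = bind_pmf \<Lambda> (\<lambda>_. pX)" by (intro bind_pmf_cong refl assms)
  finally show ?thesis by simp
qed

text \<open>Every collection containing \<open>{}\<close> gains the entropy of the index, with or
  without the source, while the law of the source is the same in all branches. The gains cancel in
  the mutual information and in all layers except \<open>{}\<close>; the gain of that layer offsets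
  the one in the source term.\<close>

lemma psi_time_share:
  assumes fin: "finite (set_pmf \<Lambda>)" "\<And>q. q \<in> set_pmf \<Lambda> \<Longrightarrow> finite (set_pmf (P q))"
    and marg: "\<And>q. q \<in> set_pmf \<Lambda> \<Longrightarrow> map_pmf fst (P q) = pX" and finK: "finite K"
  shows "psi (time_share \<Lambda> P) K = measure_pmf.expectation \<Lambda> (\<lambda>q. psi (P q) K)"
proof -
  let ?M = "time_share \<Lambda> P" and ?E = "measure_pmf.expectation \<Lambda>"
  let ?H = "ent \<Lambda> (\<lambda>q. q)"
  have finM: "finite (set_pmf ?M)" using fin by (simp add: time_share_def)
  have int [simp]: "integrable (measure_pmf \<Lambda>) f" for f :: "nat \<Rightarrow> real"
    using fin(1) by (rule integrable_measure_pmf_finite)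
  have cong: "?E f = ?E g" if "\<And>q. q \<in> set_pmf \<Lambda> \<Longrightarrow> f q = g q" for f g :: "nat \<Rightarrow> real"
    using that by (intro integral_cong_AE) (auto simp: AE_measure_pmf_iff)
  have margM: "map_pmf fst ?M = pX" by (rule map_fst_time_share[OF marg])
  have src: "ent ?M fst = ent pX (\<lambda>v. v)" "q \<in> set_pmf \<Lambda> \<Longrightarrow> ent (P q) fst = ent pX (\<lambda>v. v)" for q
    using margM marg by (simp_all add: ent_eq_map[of _ fst])
  have ce: "coll_ent ?M B = ?H + ?E (\<lambda>q. coll_ent (P q) B)" if "{} \<in> B" for B
  proof -
    have "coll_ent ?M B = ?H + ?E (\<lambda>q. ent (map_pmf (tag_layer q) (P q)) (\<lambda>w. coll B (snd w)))"
      unfolding coll_ent_def time_share_def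
      by (rule ent_bind[where \<tau> = "\<lambda>c. fst (prod_decode (c {}))"])
         (use fin that in \<open>auto simp: coll_def tag_layer_def\<close>)
    also have "?E (\<lambda>q. ent (map_pmf (tag_layer q) (P q)) (\<lambda>w. coll B (snd w))) = ?E (\<lambda>q. coll_ent (P q) B)"
      unfolding coll_ent_def ent_map
      by (rule cong, rule ent_cong_iff[OF fin(2)]) (auto simp: coll_eq_iff tag_layer_def)
    finally show ?thesis .
  qed
  have cse: "coll_src_ent ?M B = ?H + ?E (\<lambda>q. coll_src_ent (P q) B)" if "{} \<in> B" for B
  proof -
    have "coll_src_ent ?M B = ?H + ?E (\<lambda>q. ent (map_pmf (tag_layer q) (P q)) (\<lambda>w. (coll B (snd w), fst w)))"
      unfolding coll_src_ent_def time_share_def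
      by (rule ent_bind[where \<tau> = "\<lambda>c. fst (prod_decode (fst c {}))"])
         (use fin that in \<open>auto simp: coll_def tag_layer_def\<close>)
    also have "?E (\<lambda>q. ent (map_pmf (tag_layer q) (P q)) (\<lambda>w. (coll B (snd w), fst w))) = ?E (\<lambda>q. coll_src_ent (P q) B)"
      unfolding coll_src_ent_def ent_map
      by (rule cong, rule ent_cong_iff[OF fin(2)]) (auto simp: coll_eq_iff tag_layer_def)
    finally show ?thesis .
  qed
  have le: "layer_ent ?M A = ?E (\<lambda>q. layer_ent (P q) A) + (if A = {} then ?H else 0)" for A
  proof (cases "A = {}")
    case True
    then show ?thesis by (simp add: layer_ent_def coll_ent_empty ce)
  next
    case False
    then show ?thesis by (simp add: layer_ent_def ce)
  qed
  have "(\<Sum>A\<in>Pow K. layer_ent ?M A) = ?E (\<lambda>q. \<Sum>A\<in>Pow K. layer_ent (P q) A) + ?H"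
    using finK by (simp add: le sum.distrib Bochner_Integration.integral_sum)
  then have "psi ?M K = ?E (\<lambda>q. (real (card K) - 1) * (ent pX (\<lambda>v. v) + coll_ent (P q) {{}} - coll_src_ent (P q) {{}})
     - (coll_src_ent (P q) (Pow K) - ent pX (\<lambda>v. v)) + (\<Sum>A\<in>Pow K. layer_ent (P q) A))"
    unfolding psi_eq[OF finM] by (simp add: ce cse src)
  also have "\<dots> = ?E (\<lambda>q. psi (P q) K)"
    by (rule cong) (simp add: psi_eq[OF fin(2)] src)
  finally show ?thesis .
qed

text \<open>The decoder reads the index from layer \<open>{}\<close>, restores the original content
  of that layer and applies the decoder of the branch, so the distortion is an average over
  branches.\<close>

lemma expectation_time_share:
  fixes d :: "'x \<Rightarrow> 'y \<Rightarrow> real"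
  assumes fin: "finite (set_pmf \<Lambda>)" "\<And>q. q \<in> set_pmf \<Lambda> \<Longrightarrow> finite (set_pmf (P q))"
    and le: "\<And>q. q \<in> set_pmf \<Lambda> \<Longrightarrow>
      measure_pmf.expectation (P q) (\<lambda>w. d (fst w) (\<phi> q K (coll (Pow K) (snd w)))) \<le> D"
  shows "measure_pmf.expectation (time_share \<Lambda> P) (\<lambda>w. d (fst w)
     ((\<lambda>c. \<phi> (fst (prod_decode (c {}))) K (c({} := snd (prod_decode (c {}))))) (coll (Pow K) (snd w)))) \<le> D"
    (is "measure_pmf.expectation _ ?f \<le> _")
proof -
  have eq: "?f (tag_layer q w) = d (fst w) (\<phi> q K (coll (Pow K) (snd w)))" for q w
  proof -
    have "(coll (Pow K) (snd (tag_layer q w)))({} := snd w {}) = coll (Pow K) (snd w)"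
      by (auto simp: fun_eq_iff coll_def tag_layer_def)
    then show ?thesis by (simp add: coll_def tag_layer_def)
  qed
  have "measure_pmf.expectation (time_share \<Lambda> P) ?f
     = (\<Sum>q\<in>set_pmf \<Lambda>. pmf \<Lambda> q *\<^sub>R measure_pmf.expectation (map_pmf (tag_layer q) (P q)) ?f)"
    unfolding time_share_def by (rule pmf_expectation_bind) (use fin in auto)
  also have "\<dots> \<le> (\<Sum>q\<in>set_pmf \<Lambda>. pmf \<Lambda> q * D)"
    using le by (intro sum_mono) (auto simp: eq intro!: mult_left_mono)
  also have "\<dots> = D"
    using fin(1) by (simp add: sum_distrib_right[symmetric] sum_pmf_eq_1)
  finally show ?thesis .
qed

section \<open>Functional representation\<close>

text \<open>A single draw of a random function on \<open>S\<close> with independent values of laws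
  \<open>\<kappa> y\<close> serves all \<open>y\<close> simultaneously; \<open>F\<close> evaluates
  it. The function is coded as a number so that it fits into a layer.\<close>

lemma finite_coupling:
  fixes \<kappa> :: "'y \<Rightarrow> 't pmf"
  assumes finS: "finite S" and fin: "\<And>y. y \<in> S \<Longrightarrow> finite (set_pmf (\<kappa> y))"
  obtains V :: "nat pmf" and F :: "nat \<Rightarrow> 'y \<Rightarrow> 't"
  where "finite (set_pmf V)" "\<And>y. y \<in> S \<Longrightarrow> map_pmf (\<lambda>v. F v y) V = \<kappa> y"
proof -
  define Q where "Q = Pi_pmf S undefined \<kappa>"
  have finQ: "finite (set_pmf Q)"
    unfolding Q_def set_Pi_pmf[OF finS] using fin by (intro finite_PiE_dflt finS) auto
  define V where "V = map_pmf (to_nat_on (set_pmf Q)) Q"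
  have "map_pmf (\<lambda>v. from_nat_into (set_pmf Q) v y) V = \<kappa> y" if "y \<in> S" for y
  proof -
    have "map_pmf (\<lambda>v. from_nat_into (set_pmf Q) v y) V = map_pmf (\<lambda>f. f y) Q"
      unfolding V_def map_pmf_comp
      by (intro map_pmf_cong refl) simp
    also have "\<dots> = \<kappa> y" unfolding Q_def by (simp add: Pi_pmf_component[OF finS] that)
    finally show ?thesis .
  qed
  moreover have "finite (set_pmf V)" using finQ by (simp add: V_def)
  ultimately show ?thesis using that by blast
qed

lemma bind_cond_pmf_map: "bind_pmf (map_pmf f P) (\<lambda>x. cond_pmf P {w. f w = x}) = P"
proof (rule bind_cond_pmf_cancel)
  fix x y
  assume "f y = x"
  then have "{w. f w = x} = f -` {x}" "{x. f y = x} = {x}" by auto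
  then show "measure_pmf.prob P {w. f w = x} = measure_pmf.prob (map_pmf f P) {x. f y = x}"
    by simp
qed auto

text \<open>The variable \<open>T\<close> is replaced by a variable \<open>V\<close> that is independent of \<open>Y\<close>, determines
\<open>T\<close> together with \<open>Y\<close>, and is conditionally independent of \<open>X\<close> given \<open>(T, Y)\<close>; the entropy
identity is all that is needed of these independences.\<close>

lemma functional_representation:
  fixes P :: "'w pmf" and Y :: "'w \<Rightarrow> 'y" and T :: "'w \<Rightarrow> 't" and X :: "'w \<Rightarrow> 'x"
  assumes fin: "finite (set_pmf P)"
  shows "\<exists>(M :: ('w \<times> nat) pmf) F. finite (set_pmf M) \<and> map_pmf fst M = P \<and>
    (\<forall>m\<in>set_pmf M. T (fst m) = F (snd m) (Y (fst m))) \<and>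
    ent M (\<lambda>m. (Y (fst m), snd m, X (fst m)))
      = ent M snd + ent P Y + ent P (\<lambda>w. (T w, Y w, X w)) - ent P (\<lambda>w. (T w, Y w))"
proof -
  define \<kappa> where "\<kappa> y = map_pmf T (cond_pmf P {w. Y w = y})" for y
  have ne: "set_pmf P \<inter> {w. Y w = y} \<noteq> {}" if "y \<in> Y ` set_pmf P" for y
    using that by auto
  have "finite (set_pmf (\<kappa> y))" if "y \<in> Y ` set_pmf P" for y
    using fin set_cond_pmf[OF ne[OF that]] by (simp add: \<kappa>_def)
  then obtain V :: "nat pmf" and F where V: "finite (set_pmf V)"
    "\<And>y. y \<in> Y ` set_pmf P \<Longrightarrow> map_pmf (\<lambda>v. F v y) V = \<kappa> y"
    using finite_coupling[of "Y ` set_pmf P" \<kappa>] fin by (metis finite_imageI)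
  \<comment> \<open>\<open>M\<close> draws \<open>V\<close> and \<open>Y\<close> independently, sets
    \<open>T\<close> to \<open>F V Y\<close>, and then draws the whole outcome from its conditional
    law given \<open>(Y, T)\<close>. Hence \<open>V\<close> is tied to the outcome only through that
    pair.\<close>
  define C where "C yt = cond_pmf P {w. (Y w, T w) = yt}" for yt
  define N where "N = pair_pmf V (map_pmf Y P)"
  define g where "g = (\<lambda>(v, y). (y, F v y))"
  define M where "M = bind_pmf N (\<lambda>n. map_pmf (\<lambda>w. (w, fst n)) (C (g n)))"
  have finN: "finite (set_pmf N)" using V(1) fin by (simp add: N_def)
  \<comment> \<open>The pair \<open>(Y, F V Y)\<close> has the original law of
    \<open>(Y, T)\<close>, so resampling the outcome from it gives back \<open>P\<close>.\<close>
  have J: "map_pmf g N = map_pmf (\<lambda>w. (Y w, T w)) P"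
  proof -
    have "map_pmf g N = bind_pmf V (\<lambda>v. bind_pmf (map_pmf Y P) (\<lambda>y. return_pmf (y, F v y)))"
      by (simp add: N_def g_def pair_pmf_def map_bind_pmf)
    also have "\<dots> = bind_pmf (map_pmf Y P) (\<lambda>y. bind_pmf V (\<lambda>v. return_pmf (y, F v y)))"
      by (rule bind_commute_pmf)
    also have "\<dots> = bind_pmf (map_pmf Y P) (\<lambda>y. map_pmf (\<lambda>w. (Y w, T w)) (cond_pmf P {w. Y w = y}))"
    proof (intro bind_pmf_cong refl)
      fix y assume "y \<in> set_pmf (map_pmf Y P)"
      then have y: "y \<in> Y ` set_pmf P" by simp
      have "bind_pmf V (\<lambda>v. return_pmf (y, F v y)) = map_pmf (Pair y) (map_pmf (\<lambda>v. F v y) V)"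
        by (simp add: map_pmf_def bind_assoc_pmf bind_return_pmf)
      also have "\<dots> = map_pmf (\<lambda>w. (y, T w)) (cond_pmf P {w. Y w = y})"
        using V(2)[OF y] by (simp add: \<kappa>_def map_pmf_comp)
      also have "\<dots> = map_pmf (\<lambda>w. (Y w, T w)) (cond_pmf P {w. Y w = y})"
        by (intro map_pmf_cong refl) (simp add: set_cond_pmf[OF ne[OF y]])
      finally show "bind_pmf V (\<lambda>v. return_pmf (y, F v y))
        = map_pmf (\<lambda>w. (Y w, T w)) (cond_pmf P {w. Y w = y})" .
    qed
    also have "\<dots> = map_pmf (\<lambda>w. (Y w, T w)) (bind_pmf (map_pmf Y P) (\<lambda>y. cond_pmf P {w. Y w = y}))"
      by (simp only: map_bind_pmf)
    finally show ?thesis by (simp only: bind_cond_pmf_map)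
  qed
  have PC: "bind_pmf (map_pmf g N) C = P"
    unfolding J C_def by (rule bind_cond_pmf_map)
  have setC: "set_pmf (C (g n)) = {w \<in> set_pmf P. (Y w, T w) = g n}" if "n \<in> set_pmf N" for n
  proof -
    have "g n \<in> set_pmf (map_pmf (\<lambda>w. (Y w, T w)) P)" using that J[symmetric] by simp
    then have "set_pmf P \<inter> {w. (Y w, T w) = g n} \<noteq> {}" by auto
    then show ?thesis unfolding C_def by (subst set_cond_pmf) auto
  qed
  have finC: "finite (set_pmf (C (g n)))" if "n \<in> set_pmf N" for n
    using fin by (simp add: setC[OF that])
  have finM: "finite (set_pmf M)" using finN finC by (simp add: M_def)
  have "map_pmf fst M = bind_pmf N (\<lambda>n. C (g n))"
    by (simp add: M_def map_bind_pmf map_pmf_comp)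
  then have fstM: "map_pmf fst M = P" using PC by (simp add: bind_map_pmf)
  have TF: "T (fst m) = F (snd m) (Y (fst m))" if "m \<in> set_pmf M" for m
    using that setC by (force simp: M_def g_def split: prod.splits)
  have "map_pmf snd M = bind_pmf N (\<lambda>n. return_pmf (fst n))"
    by (simp add: M_def map_bind_pmf map_pmf_comp)
  also have "\<dots> = V" by (simp add: map_pmf_def[symmetric] N_def map_fst_pair_pmf)
  finally have sndM: "ent M snd = ent V (\<lambda>v. v)" by (subst ent_eq_map) simp
  have "ent N (\<lambda>n. n) = ent V (\<lambda>v. v) + measure_pmf.expectation V (\<lambda>v. ent (map_pmf (Pair v) (map_pmf Y P)) (\<lambda>n. n))"
  proof -
    have "N = bind_pmf V (\<lambda>v. map_pmf (Pair v) (map_pmf Y P))"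
      by (simp add: N_def pair_pmf_def map_pmf_def)
    then show ?thesis using V(1) fin by (simp only:) (rule ent_bind[where \<tau> = fst], auto)
  qed
  also have "(\<lambda>v. ent (map_pmf (Pair v) (map_pmf Y P)) (\<lambda>n. n)) = (\<lambda>_. ent P Y)"
  proof
    fix v
    show "ent (map_pmf (Pair v) (map_pmf Y P)) (\<lambda>n. n) = ent P Y"
      unfolding ent_map by (rule ent_cong_iff[OF fin]) simp
  qed
  finally have entN: "ent N (\<lambda>n. n) = ent V (\<lambda>v. v) + ent P Y" by simp
  let ?h = "\<lambda>yt. ent (C yt) (\<lambda>w. (T w, Y w, X w))"
  \<comment> \<open>Given \<open>V\<close> and \<open>Y\<close>, the remaining uncertainty about the
    source depends only on \<open>g n\<close>. Its mean is the conditional entropy of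
    \<open>X\<close> given \<open>(T, Y)\<close>, found by applying \<open>ent_bind\<close> to
    \<open>P\<close> split along that pair.\<close>
  have "ent M (\<lambda>m. (Y (fst m), snd m, X (fst m))) = ent N (\<lambda>n. n)
    + measure_pmf.expectation N (\<lambda>n. ent (map_pmf (\<lambda>w. (w, fst n)) (C (g n))) (\<lambda>m. (Y (fst m), snd m, X (fst m))))"
    unfolding M_def
    by (rule ent_bind[where \<tau> = "\<lambda>(y, v, x). (v, y)"])
       (use finN finC setC in \<open>auto simp: g_def split: prod.splits\<close>)
  also have "measure_pmf.expectation N (\<lambda>n. ent (map_pmf (\<lambda>w. (w, fst n)) (C (g n))) (\<lambda>m. (Y (fst m), snd m, X (fst m))))
     = measure_pmf.expectation N (\<lambda>n. ?h (g n))"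
  proof (intro integral_cong_AE)
    have "ent (map_pmf (\<lambda>w. (w, fst n)) (C (g n))) (\<lambda>m. (Y (fst m), snd m, X (fst m))) = ?h (g n)"
      if n: "n \<in> set_pmf N" for n
      unfolding ent_map fst_conv snd_conv
    proof (rule ent_cong_iff[OF finC[OF n]])
      fix w w' assume "w \<in> set_pmf (C (g n))" "w' \<in> set_pmf (C (g n))"
      then have "(Y w, T w) = (Y w', T w')" using setC[OF n] by simp
      then show "(Y w, fst n, X w) = (Y w', fst n, X w') \<longleftrightarrow> (T w, Y w, X w) = (T w', Y w', X w')"
        by simp
    qed
    then show "AE n in measure_pmf N. ent (map_pmf (\<lambda>w. (w, fst n)) (C (g n))) (\<lambda>m. (Y (fst m), snd m, X (fst m))) = ?h (g n)"
      by (simp add: AE_measure_pmf_iff)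
  qed auto
  also have "\<dots> = measure_pmf.expectation (map_pmf g N) ?h" by simp
  also have "\<dots> = ent P (\<lambda>w. (T w, Y w, X w)) - ent P (\<lambda>w. (T w, Y w))"
  proof -
    have "ent (bind_pmf (map_pmf g N) C) (\<lambda>w. (T w, Y w, X w))
      = ent (map_pmf g N) (\<lambda>j. j) + measure_pmf.expectation (map_pmf g N) ?h"
    proof (rule ent_bind[where \<tau> = "\<lambda>(t, y, x). (y, t)"])
      fix j w assume "j \<in> set_pmf (map_pmf g N)" and w: "w \<in> set_pmf (C j)"
      then obtain n where n: "n \<in> set_pmf N" "j = g n" by auto
      then have "(Y w, T w) = j" using setC[OF n(1)] w by simp
      then show "(case (T w, Y w, X w) of (t, y, x) \<Rightarrow> (y, t)) = j" by simp
    qed (use finN finC in auto)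
    moreover have "ent (map_pmf g N) (\<lambda>j. j) = ent P (\<lambda>w. (T w, Y w))"
      unfolding J ent_map by (rule ent_cong_iff[OF fin]) auto
    ultimately show ?thesis unfolding PC by simp
  qed
  finally have "ent M (\<lambda>m. (Y (fst m), snd m, X (fst m)))
      = ent M snd + ent P Y + ent P (\<lambda>w. (T w, Y w, X w)) - ent P (\<lambda>w. (T w, Y w))"
    using entN sndM by simp
  with finM fstM TF show ?thesis by blast
qed

section \<open>Removing the last refinement layer\<close>

text \<open>Here \<open>snd m\<close> is the variable \<open>V\<close> of
  \<open>functional_representation\<close>. Freezing layer \<open>I\<close> loses nothing, since its
  content can be recomputed from \<open>V\<close> and the other layers.\<close>

definition fold_layer :: "nat set \<Rightarrow> nat \<Rightarrow> ('x \<times> (nat set \<Rightarrow> nat)) \<times> nat \<Rightarrow> 'x \<times> (nat set \<Rightarrow> nat)" where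
  "fold_layer I q m = (fst (fst m), (snd (fst m))({q} := prod_encode (snd (fst m) {q}, snd m), I := 0))"

lemma coll_fold_layer_eq_iff:
  assumes "{q} \<noteq> I"
  shows "coll B (snd (fold_layer I q m)) = coll B (snd (fold_layer I q m')) \<longleftrightarrow>
    (\<forall>A\<in>B - {I}. snd (fst m) A = snd (fst m') A) \<and> ({q} \<in> B \<longrightarrow> snd m = snd m')"
  using assms by (auto simp: coll_eq_iff fold_layer_def)

lemma fst_fold_layer [simp]: "fst (fold_layer I q m) = fst (fst m)"
  by (simp add: fold_layer_def)

text \<open>For \<open>K = I\<close> the costs balance: layer \<open>{q}\<close> grows by at most
  H(V), layer \<open>I\<close> loses H(T|Y), and the source term grows by exactly H(V) - H(T|Y). The
  other layers do not grow, since those containing \<open>q\<close> are now also conditioned on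
  \<open>V\<close>. Collections containing neither \<open>{q}\<close> nor \<open>I\<close> are
  untouched.\<close>

lemma fold_refinement_layer:
  fixes P :: "'x joint"
  assumes fin: "finite (set_pmf P)" and finI: "finite I" and q: "q \<in> I" "{q} \<noteq> I"
  shows "\<exists>(P' :: 'x joint) \<rho>. finite (set_pmf P') \<and> map_pmf fst P' = map_pmf fst P \<and>
    (\<forall>w\<in>set_pmf P'. snd w I = 0) \<and>
    (\<forall>K\<subseteq>I - {q}. psi P' K = psi P K) \<and> psi P' I \<le> psi P I \<and>
    (\<forall>K\<subseteq>I. \<forall>h. measure_pmf.expectation P' (\<lambda>w. h (fst w) (\<rho> K (coll (Pow K) (snd w))) :: real)
      = measure_pmf.expectation P (\<lambda>w. h (fst w) (coll (Pow K) (snd w))))"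
proof -
  define Y where "Y w = coll (Pow I - {I}) (snd w)" for w :: "'x \<times> (nat set \<Rightarrow> nat)"
  define T where "T w = snd w I" for w :: "'x \<times> (nat set \<Rightarrow> nat)"
  obtain M :: "(('x \<times> (nat set \<Rightarrow> nat)) \<times> nat) pmf" and F where finM: "finite (set_pmf M)" and fstM: "map_pmf fst M = P"
    and TF: "\<And>m. m \<in> set_pmf M \<Longrightarrow> T (fst m) = F (snd m) (Y (fst m))"
    and entM: "ent M (\<lambda>m. (Y (fst m), snd m, fst (fst m)))
      = ent M snd + ent P Y + ent P (\<lambda>w. (T w, Y w, fst w)) - ent P (\<lambda>w. (T w, Y w))"
    using functional_representation[OF fin, of T Y fst] by blast
  define P' where "P' = map_pmf (fold_layer I q) M"
  have finP': "finite (set_pmf P')" using finM by (simp add: P'_def)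
  define G where "G B m = coll B (snd (fold_layer I q m))" for B and m :: "('x \<times> (nat set \<Rightarrow> nat)) \<times> nat"
  define H where "H B m = coll B (snd (fst m))" for B and m :: "('x \<times> (nat set \<Rightarrow> nat)) \<times> nat"
  have iff: "G B m = G B m' \<longleftrightarrow>
      (\<forall>A\<in>B - {I}. snd (fst m) A = snd (fst m') A) \<and> ({q} \<in> B \<longrightarrow> snd m = snd m')"
    "H B m = H B m' \<longleftrightarrow> (\<forall>A\<in>B. snd (fst m) A = snd (fst m') A)" for B m m'
    unfolding G_def H_def by (rule coll_fold_layer_eq_iff[OF q(2)] coll_eq_iff)+
  have Ine: "I \<noteq> {}" using q by auto
  have entP: "ent P f = ent M (\<lambda>m. f (fst m))" for f :: "'x \<times> (nat set \<Rightarrow> nat) \<Rightarrow> 'z"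
    by (subst fstM[symmetric]) (rule ent_map)
  have ce: "coll_ent P' B = ent M (G B)" "coll_src_ent P' B = ent M (\<lambda>m. (G B m, fst (fst m)))"
    "coll_ent P B = ent M (H B)" "coll_src_ent P B = ent M (\<lambda>m. (H B m, fst (fst m)))" for B
    by (simp_all add: coll_ent_def coll_src_ent_def P'_def ent_map entP G_def[abs_def] H_def[abs_def])
  have same: "coll_ent P' B = coll_ent P B" "coll_src_ent P' B = coll_src_ent P B"
    if "{q} \<notin> B" "I \<notin> B" for B
    unfolding ce by (rule ent_cong_iff[OF finM]; use that in \<open>auto simp: iff\<close>)+
  have src: "ent P' fst = ent P fst" by (simp add: P'_def ent_map entP)
  have same0: "coll_ent P' {{}} = coll_ent P {{}}" "coll_src_ent P' {{}} = coll_src_ent P {{}}"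
    using same[of "{{}}"] Ine by auto
  have layer_same: "layer_ent P' A = layer_ent P A" if "A \<subseteq> I" "A \<noteq> I" "q \<notin> A" for A
    unfolding layer_ent_def using that by (subst (1 2) same) auto
  have psi_same: "psi P' K = psi P K" if K: "K \<subseteq> I - {q}" for K
  proof -
    have "coll_src_ent P' (Pow K) = coll_src_ent P (Pow K)" using K q by (intro same) auto
    moreover have "sum (layer_ent P') (Pow K) = sum (layer_ent P) (Pow K)"
      using K q by (intro sum.cong layer_same) auto
    ultimately show ?thesis unfolding psi_eq[OF finP'] psi_eq[OF fin] src same0 by simp
  qed
  have layer_le: "layer_ent P' A \<le> layer_ent P A" if A: "A \<subseteq> I" "A \<noteq> I" "A \<noteq> {q}" for A
  proof (cases "q \<in> A")
    case False
    with A show ?thesis by (simp add: layer_same)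
  next
    case True
    have "coll_ent P' (Pow A) + coll_ent P (Pow A - {A}) \<le> coll_ent P' (Pow A - {A}) + coll_ent P (Pow A)"
      unfolding ce
      by (rule ent_submodular[OF finM]) (use A True in \<open>auto simp: iff\<close>)
    then show ?thesis by (simp add: layer_ent_def)
  qed
  have layer_q: "layer_ent P' {q} \<le> layer_ent P {q} + ent M snd"
  proof -
    \<comment> \<open>A constant common part turns submodularity into subadditivity.\<close>
    have "coll_ent P' (Pow {q}) + ent M (\<lambda>_. ()) \<le> coll_ent P (Pow {q}) + ent M snd"
      unfolding ce
      by (rule ent_submodular[OF finM]) (use q in \<open>auto simp: iff\<close>)
    moreover have "coll_ent P' (Pow {q} - {{q}}) = coll_ent P (Pow {q} - {{q}})"
      using q Ine by (intro same) auto
    ultimately show ?thesis by (simp add: layer_ent_def ent_const[of M "\<lambda>_. ()"])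
  qed
  have layer_I: "layer_ent P' I = 0"
  proof -
    have "coll_ent P' (Pow I) = coll_ent P' (Pow I - {I})"
      unfolding ce by (rule ent_cong_iff[OF finM]) (use q in \<open>auto simp: iff\<close>)
    then show ?thesis by (simp add: layer_ent_def)
  qed
  have split: "sum f (Pow I) = f I + (f {q} + sum f (Pow I - {I} - {{q}}))" for f :: "nat set \<Rightarrow> real"
  proof -
    have "sum f (Pow I) = f I + sum f (Pow I - {I})" using finI by (intro sum.remove) auto
    also have "sum f (Pow I - {I}) = f {q} + sum f (Pow I - {I} - {{q}})"
      using finI q by (intro sum.remove) auto
    finally show ?thesis .
  qed
  have srcI: "coll_src_ent P' (Pow I)
     = ent M snd + coll_ent P (Pow I - {I}) + coll_src_ent P (Pow I) - coll_ent P (Pow I)"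
  proof -
    have "Y (fst m) = H (Pow I - {I}) m" for m by (simp add: Y_def H_def)
    then have "coll_src_ent P' (Pow I) = ent M (\<lambda>m. (Y (fst m), snd m, fst (fst m)))"
      unfolding ce by (intro ent_cong_iff[OF finM]) (use q in \<open>auto simp: iff\<close>)
    moreover have "ent P (\<lambda>w. (T w, Y w, fst w)) = coll_src_ent P (Pow I)"
      unfolding coll_src_ent_def by (rule ent_cong_iff[OF fin]) (auto simp: Y_def T_def coll_eq_iff)
    moreover have "ent P (\<lambda>w. (T w, Y w)) = coll_ent P (Pow I)"
      unfolding coll_ent_def by (rule ent_cong_iff[OF fin]) (auto simp: Y_def T_def coll_eq_iff)
    moreover have "ent P Y = coll_ent P (Pow I - {I})" by (simp add: coll_ent_def Y_def[abs_def])
    ultimately show ?thesis using entM by simp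
  qed
  have "sum (layer_ent P') (Pow I - {I} - {{q}}) \<le> sum (layer_ent P) (Pow I - {I} - {{q}})"
    by (intro sum_mono layer_le) auto
  then have psiI: "psi P' I \<le> psi P I"
    unfolding psi_eq[OF finP'] psi_eq[OF fin] split src same0 srcI layer_I
    using layer_q unfolding layer_ent_def[of P I] by linarith
  \<comment> \<open>\<open>\<rho>'\<close> strips \<open>V\<close> from layer \<open>{q}\<close>.
    \<open>\<rho>\<close> also recomputes layer \<open>I\<close>, but only for \<open>K = I\<close>,
    the one subset of \<open>I\<close> whose collection contains that layer.\<close>
  define \<rho>' where "\<rho>' K c = (if q \<in> K then c({q} := fst (prod_decode (c {q}))) else c)" for K c
  define \<rho> where "\<rho> K c = (if K = I then (\<rho>' K c)(I := F (snd (prod_decode (c {q}))) (coll (Pow I - {I}) (\<rho>' K c))) else \<rho>' K c)"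
    for K c
  have \<rho>: "\<rho> K (coll (Pow K) (snd (fold_layer I q m))) = coll (Pow K) (snd (fst m))"
    if K: "K \<subseteq> I" and m: "m \<in> set_pmf M" for K m
  proof -
    let ?c = "coll (Pow K) (snd (fold_layer I q m))"
    have \<rho>': "\<rho>' K ?c A = coll (Pow K) (snd (fst m)) A" if "A \<noteq> I" for A
      using that q K by (auto simp: \<rho>'_def coll_def fold_layer_def)
    show ?thesis
    proof (cases "K = I")
      case False
      then have "\<rho>' K ?c I = coll (Pow K) (snd (fst m)) I"
        using K q by (auto simp: \<rho>'_def coll_def)
      then have "\<rho>' K ?c A = coll (Pow K) (snd (fst m)) A" for A
        using \<rho>' by (cases "A = I") auto
      then show ?thesis using False by (simp add: \<rho>_def fun_eq_iff)
    next
      case True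
      have "snd (prod_decode (?c {q})) = snd m"
        using True q by (auto simp: coll_def fold_layer_def)
      moreover have "coll (Pow I - {I}) (\<rho>' K ?c) = Y (fst m)"
        unfolding Y_def coll_eq_iff using \<rho>' True by (auto simp: coll_def)
      ultimately have "\<rho> K ?c I = T (fst m)" using True TF[OF m] by (simp add: \<rho>_def)
      then have "\<rho> K ?c A = coll (Pow K) (snd (fst m)) A" for A
        using True \<rho>' by (cases "A = I") (simp_all add: \<rho>_def T_def coll_def)
      then show ?thesis by blast
    qed
  qed
  show ?thesis
  proof (intro exI[of _ P'] exI[of _ \<rho>] conjI allI impI ballI)
    show "psi P' I \<le> psi P I" by (rule psiI)
    show "psi P' K = psi P K" if "K \<subseteq> I - {q}" for K by (rule psi_same[OF that])
    show "finite (set_pmf P')" by (rule finP')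
    show "map_pmf fst P' = map_pmf fst P"
      by (simp add: P'_def map_pmf_comp fstM[symmetric])
    show "snd w I = 0" if "w \<in> set_pmf P'" for w
      using that by (auto simp: P'_def fold_layer_def)
    show "measure_pmf.expectation P' (\<lambda>w. h (fst w) (\<rho> K (coll (Pow K) (snd w))) :: real)
      = measure_pmf.expectation P (\<lambda>w. h (fst w) (coll (Pow K) (snd w)))" if "K \<subseteq> I" for K h
    proof -
      have "measure_pmf.expectation P' (\<lambda>w. h (fst w) (\<rho> K (coll (Pow K) (snd w))))
        = measure_pmf.expectation M (\<lambda>m. h (fst (fst m)) (\<rho> K (coll (Pow K) (snd (fold_layer I q m)))))"
        by (simp add: P'_def)
      also have "\<dots> = measure_pmf.expectation M (\<lambda>m. h (fst (fst m)) (coll (Pow K) (snd (fst m))))"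
        by (intro integral_cong_AE) (simp_all add: AE_measure_pmf_iff \<rho>[OF that])
      also have "\<dots> = measure_pmf.expectation P (\<lambda>w. h (fst w) (coll (Pow K) (snd w)))"
        by (simp add: fstM[symmetric])
      finally show ?thesis .
    qed
  qed
qed

text \<open>With a single description the mutual information term has coefficient 0, and
  \<open>psi\<close> at \<open>I\<close> depends only on the pair of layers \<open>{}\<close> and
  \<open>I\<close>. Storing that pair in layer \<open>{}\<close> therefore leaves it
  unchanged.\<close>

lemma merge_refinement_layer:
  fixes P :: "'x joint"
  assumes fin: "finite (set_pmf P)" and I: "I = {i}"
  shows "\<exists>(P' :: 'x joint) \<rho>. finite (set_pmf P') \<and> map_pmf fst P' = map_pmf fst P \<and>
    (\<forall>w\<in>set_pmf P'. snd w I = 0) \<and> psi P' I = psi P I \<and>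
    (\<forall>h. measure_pmf.expectation P' (\<lambda>w. h (fst w) (\<rho> (coll (Pow I) (snd w))) :: real)
      = measure_pmf.expectation P (\<lambda>w. h (fst w) (coll (Pow I) (snd w))))"
proof -
  define m where "m w = (fst w, (snd w)({} := prod_encode (snd w {}, snd w I), I := 0))"
    for w :: "'x \<times> (nat set \<Rightarrow> nat)"
  define P' where "P' = map_pmf m P"
  define \<rho> where "\<rho> c = (c({} := fst (prod_decode (c {})), I := snd (prod_decode (c {}))))"
    for c :: "nat set \<Rightarrow> nat"
  have PowI: "Pow I = {{}, I}" "Pow I - {I} = {{}}" "I \<noteq> {}" using I by auto
  have psi1: "psi Q I = ent Q fst - coll_src_ent Q (Pow I) + coll_ent Q (Pow I)"
    if "finite (set_pmf Q)" for Q :: "'x joint"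
  proof -
    have "sum (layer_ent Q) (Pow I) = layer_ent Q {} + layer_ent Q I" using PowI by simp
    then show ?thesis using PowI(2)
      by (simp add: psi_eq[OF that] layer_ent_def coll_ent_empty) (simp add: I)
  qed
  have "ent P' fst = ent P fst" by (simp add: P'_def ent_map m_def)
  moreover have "coll_ent P' (Pow I) = coll_ent P (Pow I)"
    unfolding coll_ent_def P'_def ent_map
    by (rule ent_cong_iff[OF fin]) (use PowI in \<open>auto simp: coll_eq_iff m_def\<close>)
  moreover have "coll_src_ent P' (Pow I) = coll_src_ent P (Pow I)"
    unfolding coll_src_ent_def P'_def ent_map
    by (rule ent_cong_iff[OF fin]) (use PowI in \<open>auto simp: coll_eq_iff m_def\<close>)
  moreover have finP': "finite (set_pmf P')" using fin by (simp add: P'_def)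
  ultimately have "psi P' I = psi P I" using fin by (simp add: psi1)
  moreover have "\<rho> (coll (Pow I) (snd (m w))) = coll (Pow I) (snd w)" for w
    using PowI by (auto simp: \<rho>_def m_def coll_def fun_eq_iff)
  then have "\<forall>h. measure_pmf.expectation P' (\<lambda>w. h (fst w) (\<rho> (coll (Pow I) (snd w))) :: real)
      = measure_pmf.expectation P (\<lambda>w. h (fst w) (coll (Pow I) (snd w)))"
    by (simp add: P'_def) (simp add: m_def)
  moreover have "map_pmf fst P' = map_pmf fst P" by (simp add: P'_def map_pmf_comp m_def)
  moreover have "\<forall>w\<in>set_pmf P'. snd w I = 0" by (auto simp: P'_def m_def)
  ultimately show ?thesis using finP' by blast
qed

section \<open>Equality of the two regions\<close>

lemma in_VKG_star_of_in_VKG: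
  fixes pX :: "'x pmf" and d :: "'x \<Rightarrow> 'y \<Rightarrow> real"
  assumes L: "L \<ge> 1" and VKG: "in_VKG pX d L R D"
  shows "in_VKG_star pX d L R D"
proof -
  let ?I = "{1..L}"
  obtain P \<phi> where P: "map_pmf fst P = pX" "finite (set_pmf P)"
    and rate: "\<And>K. K \<noteq> {} \<Longrightarrow> K \<subseteq> ?I \<Longrightarrow> psi P K \<le> sum R K"
    and dist: "\<And>K. K \<noteq> {} \<Longrightarrow> K \<subseteq> ?I \<Longrightarrow>
      measure_pmf.expectation P (\<lambda>w. d (fst w) (\<phi> K (coll (Pow K) (snd w)))) \<le> D K"
    using VKG unfolding in_VKG_def admissible_def region_cond_def by blast
  show ?thesis
  proof (cases "L = 1")
    case True
    then have I1: "?I = {1}" by simp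
    obtain P' :: "'x joint" and \<rho> where P': "finite (set_pmf P')" "map_pmf fst P' = map_pmf fst P"
      "\<forall>w\<in>set_pmf P'. snd w ?I = 0" "psi P' ?I = psi P ?I"
      "\<And>h. measure_pmf.expectation P' (\<lambda>w. h (fst w) (\<rho> (coll (Pow ?I) (snd w))) :: real)
        = measure_pmf.expectation P (\<lambda>w. h (fst w) (coll (Pow ?I) (snd w)))"
      using merge_refinement_layer[OF P(2) I1] by blast
    have "region_cond pX d L R D P' (\<lambda>K c. \<phi> K (\<rho> c))"
      unfolding region_cond_def
    proof (intro allI impI)
      fix K assume K: "K \<noteq> {} \<and> K \<subseteq> ?I"
      then have "K = ?I" unfolding I1 by blast
      moreover have "measure_pmf.expectation P' (\<lambda>w. d (fst w) (\<phi> ?I (\<rho> (coll (Pow ?I) (snd w)))))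
        = measure_pmf.expectation P (\<lambda>w. d (fst w) (\<phi> ?I (coll (Pow ?I) (snd w))))"
        by (rule P'(5)[of "\<lambda>x c. d x (\<phi> ?I c)"])
      ultimately show "psi P' K \<le> sum R K \<and>
        measure_pmf.expectation P' (\<lambda>w. d (fst w) (\<phi> K (\<rho> (coll (Pow K) (snd w))))) \<le> D K"
        using rate[of K] dist[of K] K P'(4) by simp
    qed
    then show ?thesis using P P' unfolding in_VKG_star_def admissible_def by blast
  next
    case False
    then have ne: "{q} \<noteq> ?I" for q using L by (metis atLeastAtMost_singleton_iff)
    \<comment> \<open>Bundling the properties into one predicate lets \<open>P'\<close> and
      \<open>\<rho>\<close> be chosen for all \<open>q\<close> together.\<close>
    define folded where "folded q P' \<rho> \<longleftrightarrow> finite (set_pmf P') \<and> map_pmf fst P' = map_pmf fst P \<and>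
      (\<forall>w\<in>set_pmf P'. snd w ?I = 0) \<and>
      (\<forall>K\<subseteq>?I - {q}. psi P' K = psi P K) \<and> psi P' ?I \<le> psi P ?I \<and>
      (\<forall>K\<subseteq>?I. \<forall>h. measure_pmf.expectation P' (\<lambda>w. h (fst w) (\<rho> K (coll (Pow K) (snd w))) :: real)
        = measure_pmf.expectation P (\<lambda>w. h (fst w) (coll (Pow K) (snd w))))"
      for q and P' :: "'x joint" and \<rho>
    have "\<exists>P' \<rho>. folded q P' \<rho>" if "q \<in> ?I" for q
      unfolding folded_def by (rule fold_refinement_layer[OF P(2) _ that ne]) simp
    then obtain P' \<rho> where folded: "\<And>q. q \<in> ?I \<Longrightarrow> folded q (P' q) (\<rho> q)" by metis
    note folded' = folded[unfolded folded_def P(1)]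
    have fin: "finite (set_pmf (P' q))" if "q \<in> ?I" for q using folded'[OF that] by blast
    have marg: "map_pmf fst (P' q) = pX" if "q \<in> ?I" for q using folded'[OF that] by blast
    have const: "snd w ?I = 0" if "q \<in> ?I" "w \<in> set_pmf (P' q)" for q w
      using folded'[OF that(1)] that(2) by blast
    have psi_eq: "psi (P' q) K = psi P K" if "q \<in> ?I" "K \<subseteq> ?I - {q}" for q K
      using folded'[OF that(1)] that(2) by blast
    have psi_le: "psi (P' q) ?I \<le> psi P ?I" if "q \<in> ?I" for q using folded'[OF that] by blast
    have ex: "measure_pmf.expectation (P' q) (\<lambda>w. h (fst w) (\<rho> q K (coll (Pow K) (snd w))) :: real)
        = measure_pmf.expectation P (\<lambda>w. h (fst w) (coll (Pow K) (snd w)))"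
      if "q \<in> ?I" "K \<subseteq> ?I" for q K h
      using folded'[OF that(1)] that(2) by blast
    have feas: "psi P K \<le> sum R K" if "K \<subseteq> ?I" for K
      using rate[OF _ that] psi_empty[OF P(2)] by (cases "K = {}") simp_all
    obtain \<Lambda> where \<Lambda>: "set_pmf \<Lambda> \<subseteq> ?I"
      and mix: "\<And>K. K \<subseteq> ?I \<Longrightarrow> measure_pmf.expectation \<Lambda> (\<lambda>k. psi (P' k) K) \<le> sum R K"
      using contrapolymatroid_mixture[of ?I "psi P" "\<lambda>k. psi (P' k)" R, OF _ _
          psi_supermodular[OF P(2)] psi_empty[OF P(2)] psi_supermodular[OF fin] psi_eq psi_le feas] L
      by auto
    have fin\<Lambda>: "finite (set_pmf \<Lambda>)" using \<Lambda> by (rule finite_subset) simp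
    have fin': "finite (set_pmf (P' q))" if "q \<in> set_pmf \<Lambda>" for q using fin \<Lambda> that by blast
    have marg': "map_pmf fst (P' q) = pX" if "q \<in> set_pmf \<Lambda>" for q using marg \<Lambda> that by blast
    \<comment> \<open>Decoding reads the index, undoes the folding of that branch and then applies
      the original decoder.\<close>
    define \<phi>' where "\<phi>' K c = \<phi> K (\<rho> (fst (prod_decode (c {}))) K (c({} := snd (prod_decode (c {})))))"
      for K c
    have "region_cond pX d L R D (time_share \<Lambda> P') \<phi>'"
      unfolding region_cond_def
    proof (intro allI impI conjI)
      fix K assume K: "K \<noteq> {} \<and> K \<subseteq> ?I"
      then have "finite K" using finite_subset[of K ?I] by simp
      then show "psi (time_share \<Lambda> P') K \<le> sum R K"
        using psi_time_share[OF fin\<Lambda> fin' marg'] mix K by simp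
      have le: "measure_pmf.expectation (P' q) (\<lambda>w. d (fst w) (\<phi> K (\<rho> q K (coll (Pow K) (snd w))))) \<le> D K"
        if "q \<in> set_pmf \<Lambda>" for q
      proof -
        have "q \<in> ?I" using \<Lambda> that by blast
        then have "measure_pmf.expectation (P' q) (\<lambda>w. d (fst w) (\<phi> K (\<rho> q K (coll (Pow K) (snd w)))))
          = measure_pmf.expectation P (\<lambda>w. d (fst w) (\<phi> K (coll (Pow K) (snd w))))"
          using K by (intro ex[where h = "\<lambda>x c. d x (\<phi> K c)"]) auto
        then show ?thesis using dist[of K] K by simp
      qed
      show "measure_pmf.expectation (time_share \<Lambda> P') (\<lambda>w. d (fst w) (\<phi>' K (coll (Pow K) (snd w)))) \<le> D K"
        unfolding \<phi>'_def
        by (rule expectation_time_share[where \<phi> = "\<lambda>q K c. \<phi> K (\<rho> q K c)", OF fin\<Lambda> fin' le])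
    qed
    moreover have "admissible pX L (time_share \<Lambda> P')"
      unfolding admissible_def using fin\<Lambda> fin' map_fst_time_share[of \<Lambda> P' pX] marg'
      by (simp add: time_share_def)
    \<comment> \<open>All branches share the same constant 0, and tagging alters only layer
      \<open>{}\<close>, which differs from \<open>{1..L}\<close> because L \<ge> 1.\<close>
    moreover have "snd w ?I = 0" if "w \<in> set_pmf (time_share \<Lambda> P')" for w
      using that \<Lambda> const L by (fastforce simp: time_share_def tag_layer_def)
    ultimately show ?thesis unfolding in_VKG_star_def by blast
  qed
qed

theorem theorem2:
  fixes pX :: "'x::finite pmf" and d :: "'x \<Rightarrow> 'y::finite \<Rightarrow> real" and L :: nat
  assumes "L \<ge> 1" and "\<And>x y. d x y \<ge> 0"
  shows "{(R, D). in_VKG_star pX d L R D} = {(R, D). in_VKG pX d L R D}"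
  \<comment> \<open>The converse inclusion just drops the constancy requirement.\<close>
  using in_VKG_star_of_in_VKG[OF assms(1)] unfolding in_VKG_star_def in_VKG_def by blast

end
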